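(* Let $u:\mathbb{R}^{n}\rightarrow\mathbb{R}$ be a $C^{2}$ strictly convex solution of $$\det D^{2}u=\exp\Big\{n\Big(-u+\frac{1}{2}\sum_{i=1}^{n}x_{i}\frac{\partial u}{\partial x_{i}}\Big)\Big\}\quad\text{on }\mathbb{R}^n,$$ which satisfies $$\liminf_{x\rightarrow\infty}|x|^{2}\mu(x)>\frac{2(n-1)}{n},$$ where $\mu(x)$ is the smallest eigenvalue of $D^{2}u(x)$. Then $u$ must be a quadratic polynomial. Furthermore, there exists a symmetric real matrix $A$ such that $$u(x)=u(0)+\frac{1}{2}\langle x,Ax\rangle\quad\text{for all }x\in\mathbb{R}^n,$$ where $\det A=e^{-nu(0)}$.
   Context: $\langle\cdot,\cdot\rangle$ is the standard inner product on $\mathbb{R}^n$. *)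

theory Defs
  imports "HOL-Analysis.Analysis"
begin

text \<open>The partial derivative is the Frechet derivative applied to the standard basis vector
  \<open>axis i 1\<close>. It is only meaningful where the function is differentiable, which
  \<open>C1_on_space\<close> and \<open>C2_on_space\<close> require explicitly.\<close>

definition partial_deriv :: "'n \<Rightarrow> (real ^ 'n \<Rightarrow> real) \<Rightarrow> real ^ 'n \<Rightarrow> real" where
  "partial_deriv i f x = frechet_derivative f (at x) (axis i 1)"

definition C1_on_space :: "(real ^ 'n \<Rightarrow> real) \<Rightarrow> bool" where
  "C1_on_space f \<longleftrightarrow>
     (\<forall>x. f differentiable (at x)) \<and> (\<forall>i. continuous_on UNIV (partial_deriv i f))"

definition C2_on_space :: "(real ^ 'n \<Rightarrow> real) \<Rightarrow> bool" where
  "C2_on_space f \<longleftrightarrow> C1_on_space f \<and> (\<forall>i. C1_on_space (partial_deriv i f))"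

definition hessian :: "(real ^ 'n \<Rightarrow> real) \<Rightarrow> real ^ 'n \<Rightarrow> real ^ 'n ^ 'n" where
  "hessian f x = (\<chi> i j. partial_deriv i (partial_deriv j f) x)"

definition strictly_convex :: "(real ^ 'n \<Rightarrow> real) \<Rightarrow> bool" where
  "strictly_convex f \<longleftrightarrow>
     (\<forall>x y t. x \<noteq> y \<longrightarrow> 0 < t \<longrightarrow> t < 1 \<longrightarrow>
        f ((1 - t) *\<^sub>R x + t *\<^sub>R y) < (1 - t) * f x + t * f y)"

definition eigenvalues :: "real ^ 'n ^ 'n \<Rightarrow> real set" where
  "eigenvalues A = {c. \<exists>v. v \<noteq> 0 \<and> A *v v = c *\<^sub>R v}"

text \<open>The set of eigenvalues is always finite; it is nonempty for symmetric matrices, such as the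
  Hessian of a \<open>C\<^sup>2\<close> function.\<close>

definition smallest_eigenvalue :: "real ^ 'n ^ 'n \<Rightarrow> real" where
  "smallest_eigenvalue A = Min (eigenvalues A)"

text \<open>Polynomials of degree exactly two: since the coefficient matrix is symmetric, the quadratic
  part vanishes only if the matrix is zero.\<close>

definition quadratic_polynomial :: "(real ^ 'n \<Rightarrow> real) \<Rightarrow> bool" where
  "quadratic_polynomial f \<longleftrightarrow>
     (\<exists>(A :: real ^ 'n ^ 'n) b c. transpose A = A \<and> A \<noteq> 0 \<and>
        (\<forall>x. f x = x \<bullet> (A *v x) + b \<bullet> x + c))"

end

theory Submission
  imports Defs
begin

text \<open>
  Write \<open>H\<close> for the Hessian of \<open>u\<close> and \<open>\<phi> = n (- u + x \<bullet> Du / 2)\<close>, so that the equation reads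
  \<open>ln (det H) = \<phi>\<close>. Formally, \<open>D\<^sup>2\<phi>\<close> is \<open>n / 2\<close> times the derivative of
  \<open>H\<close> in the direction \<open>x\<close>, and differentiating the equation in that direction shows that the phase \<open>\<phi>\<close>
  solves \<open>tr (H\<^sup>-\<^sup>1 D\<^sup>2\<phi>) = (n / 2) (x \<bullet> D\<phi>)\<close>, a linear elliptic equation without zeroth order term.
  If \<open>\<phi>\<close> attains its minimum, the strong minimum principle makes it constant; then
  \<open>D\<phi> = (n / 2) (H x - Du)\<close> vanishes, so \<open>Du\<close> is homogeneous of degree one along rays, hence equal
  to its own linearisation \<open>H 0 x\<close> at the origin, and \<open>u\<close> is quadratic.

  The growth assumption is what makes the minimum exist. It gives \<open>\<phi> \<ge> n ln (c / |x|\<^sup>2)\<close> near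
  infinity, so \<open>\<phi> + \<epsilon> sqrt (1 + |x|\<^sup>2)\<close> is coercive for every \<open>\<epsilon> > 0\<close>. The eigenvalues of
  \<open>H\<^sup>-\<^sup>1\<close> are at most \<open>|x|\<^sup>2 / c\<close> there, and when the operator is applied to
  \<open>sqrt (1 + |x|\<^sup>2)\<close>, the contribution of the radial direction cancels up to a bounded remainder. The
  condition \<open>c > 2 (n - 1) / n\<close> says exactly that the other \<open>n - 1\<close> directions are beaten by the
  drift term, so a minimum of the perturbed phase cannot lie outside a fixed ball
  (\<open>hyperbolic_barrier_touching\<close>, \<open>phase_attains_min\<close>).

  The formal computation needs three derivatives of \<open>u\<close>, but \<open>u\<close> is only \<open>C\<^sup>2\<close> and \<open>\<phi>\<close> only \<open>C\<^sup>1\<close>. Instead of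
  proving regularity, the differential inequality is established in the viscosity sense
  (\<open>viscosity_inequality\<close>), which is all that the comparison arguments use. The equation is compatible
  with the dilations \<open>u\<^sub>\<lambda> x = u (\<lambda> x) / \<lambda>\<^sup>2\<close>: the Hessian of \<open>u\<^sub>\<lambda>\<close> at \<open>x\<close> is \<open>H (\<lambda> x)\<close>, and the
  \<open>\<lambda>\<close>-derivative of \<open>u\<^sub>\<lambda>\<close> at \<open>\<lambda> = 1\<close> is \<open>(2 / n) \<phi>\<close>. So \<open>\<phi>\<close> is a limit of difference quotients of
  dilations, which are \<open>C\<^sup>2\<close>; at a minimum of such a quotient minus a test function the Hessians can be
  compared, and concavity of \<open>ln det\<close> (\<open>det_le_exp_trace\<close>) turns the comparison of Hessians into
  a difference \<open>\<phi> (\<lambda> x) - \<phi> x\<close>, which divided by \<open>\<lambda> - 1\<close> tends to the first order term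
  \<open>x \<bullet> D\<phi>\<close>.
\<close>

section \<open>Spectral theory of symmetric matrices\<close>

definition pos_def :: "real ^ 'n ^ 'n \<Rightarrow> bool" where
  "pos_def A \<longleftrightarrow> transpose A = A \<and> (\<forall>v. v \<noteq> 0 \<longrightarrow> 0 < v \<bullet> (A *v v))"

lemma pos_def_symmetric: "pos_def A \<Longrightarrow> transpose A = A"
  by (simp add: pos_def_def)

lemma symmetric_form:
  fixes A :: "real ^ 'n ^ 'n"
  assumes "transpose A = A"
  shows "(A *v x) \<bullet> y = x \<bullet> (A *v y)"
  by (metis assms dot_lmul_matrix transpose_matrix_vector)

text \<open>A form that is nonnegative on a subspace is minimal at its null vectors, so its first variation
  vanishes there. Testing with \<open>v + t w\<close> for one suitable \<open>t\<close> is enough.\<close>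

lemma psd_kernel:
  fixes N :: "real ^ 'n ^ 'n"
  assumes sym: "transpose N = N" and V: "subspace V"
    and psd: "\<And>w. w \<in> V \<Longrightarrow> 0 \<le> w \<bullet> (N *v w)"
    and v: "v \<in> V" "v \<bullet> (N *v v) = 0" and w: "w \<in> V"
  shows "w \<bullet> (N *v v) = 0"
proof (rule ccontr)
  define b c where "b = w \<bullet> (N *v v)" and "c = w \<bullet> (N *v w)"
  assume "w \<bullet> (N *v v) \<noteq> 0"
  then have b: "b \<noteq> 0" by (simp add: b_def)
  have c: "c \<ge> 0" using psd[OF w] by (simp add: c_def)
  \<comment> \<open>The denominator \<open>c + 1\<close> instead of \<open>c\<close> covers the case \<open>c = 0\<close>.\<close>
  define t where "t = - b / (c + 1)"
  have "v + t *\<^sub>R w \<in> V"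
    using V v w by (simp add: subspace_add subspace_scale)
  then have "0 \<le> (v + t *\<^sub>R w) \<bullet> (N *v (v + t *\<^sub>R w))" by (rule psd)
  also have "\<dots> = 2 * t * b + t\<^sup>2 * c"
    using v(2) symmetric_form[OF sym, of v w]
    by (simp add: matrix_vector_right_distrib matrix_vector_mult_scaleR inner_add b_def c_def
        power2_eq_square inner_commute algebra_simps)
  also have "b = - (t * (c + 1))"
    using c by (simp add: t_def)
  also have "2 * t * - (t * (c + 1)) + t\<^sup>2 * c = - (t\<^sup>2 * (c + 2))"
    by (simp add: algebra_simps power2_eq_square)
  also have "\<dots> < 0"
    using b c by (simp add: t_def zero_less_mult_iff)
  finally show False by simp
qed

text \<open>At a minimiser \<open>v\<close> of the Rayleigh quotient the form of \<open>M - l I\<close> is nonnegative on \<open>V\<close> and null at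
  \<open>v\<close>, so \<open>M v - l v\<close> is orthogonal to all of \<open>V\<close>, in which it lies. Working in an invariant subspace
  lets the spectral theorem collect eigenvectors one at a time.\<close>

lemma rayleigh_minimum_eigenvector:
  fixes M :: "real ^ 'n ^ 'n"
  assumes sym: "transpose M = M" and V: "subspace V" and nz: "x0 \<in> V" "x0 \<noteq> 0"
    and inv: "\<And>x. x \<in> V \<Longrightarrow> M *v x \<in> V"
  obtains v l where "v \<in> V" "norm v = 1" "M *v v = l *\<^sub>R v"
    "\<And>w. w \<in> V \<Longrightarrow> l * (w \<bullet> w) \<le> w \<bullet> (M *v w)"
proof -
  have "compact (sphere 0 1 \<inter> V)"
    using V by (simp add: closed_subspace compact_Int_closed)
  moreover have "(1 / norm x0) *\<^sub>R x0 \<in> sphere 0 1 \<inter> V"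
    using nz V by (simp add: subspace_scale)
  moreover have "continuous_on (sphere 0 1 \<inter> V) (\<lambda>x. x \<bullet> (M *v x))"
    by (intro continuous_intros linear_continuous_on matrix_vector_mul_bounded_linear)
  ultimately have "\<exists>v\<in>sphere 0 1 \<inter> V. \<forall>y\<in>sphere 0 1 \<inter> V. v \<bullet> (M *v v) \<le> y \<bullet> (M *v y)"
    by (intro continuous_attains_inf) blast+
  then obtain v where v: "v \<in> V" "norm v = 1"
    and min: "\<And>y. y \<in> V \<Longrightarrow> norm y = 1 \<Longrightarrow> v \<bullet> (M *v v) \<le> y \<bullet> (M *v y)"
    by auto
  define l where "l = v \<bullet> (M *v v)"
  have low: "l * (w \<bullet> w) \<le> w \<bullet> (M *v w)" if "w \<in> V" for w
  proof (cases "w = 0")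
    case False
    have "l \<le> ((1 / norm w) *\<^sub>R w) \<bullet> (M *v ((1 / norm w) *\<^sub>R w))"
      unfolding l_def using False V that by (intro min) (simp_all add: subspace_scale)
    also have "\<dots> = (w \<bullet> (M *v w)) / (w \<bullet> w)"
      using False
      by (simp add: matrix_vector_mult_scaleR dot_square_norm power2_eq_square)
    finally show ?thesis
      using False by (simp add: field_simps)
  qed simp
  define N where "N = M - l *\<^sub>R mat 1"
  have Nv: "N *v w = M *v w - l *\<^sub>R w" for w
    by (simp add: N_def matrix_vector_mult_diff_rdistrib flip: scaleR_matrix_vector_assoc)
  have "transpose N = N"
    using sym by (simp add: N_def transpose_def vec_eq_iff mat_def)
  moreover have "M *v v - l *\<^sub>R v \<in> V"
    using inv v V by (simp add: subspace_diff subspace_scale)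
  moreover have "v \<bullet> (N *v v) = 0"
    using v by (simp add: Nv inner_diff_right l_def dot_square_norm)
  moreover have "0 \<le> w \<bullet> (N *v w)" if "w \<in> V" for w
    using low[OF that] by (simp add: Nv inner_diff_right)
  ultimately have "(M *v v - l *\<^sub>R v) \<bullet> (N *v v) = 0"
    using psd_kernel V v by metis
  then have "M *v v = l *\<^sub>R v" by (simp add: Nv)
  with v low show ?thesis using that by blast
qed

lemma congruence_entry:
  fixes M S :: "real ^ 'n ^ 'n"
  shows "(transpose S ** M ** S) $ i $ j = column i S \<bullet> (M *v column j S)"
proof -
  have "(transpose S ** M ** S) $ i $ j = (\<Sum>k\<in>UNIV. \<Sum>l\<in>UNIV. S $ l $ i * M $ l $ k * S $ k $ j)"
    by (simp add: matrix_matrix_mult_def transpose_def sum_distrib_right)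
  also have "\<dots> = (\<Sum>l\<in>UNIV. \<Sum>k\<in>UNIV. S $ l $ i * M $ l $ k * S $ k $ j)"
    by (rule sum.swap)
  also have "\<dots> = column i S \<bullet> (M *v column j S)"
    by (simp add: inner_vec_def matrix_vector_mult_def column_def sum_distrib_left mult.assoc)
  finally show ?thesis .
qed

text \<open>The orthogonal complement of any set of orthonormal eigenvectors is invariant, so as long as it is
  nontrivial it contains a further eigenvector.\<close>

lemma spectral_theorem:
  fixes M :: "real ^ 'n ^ 'n"
  assumes sym: "transpose M = M"
  obtains Q :: "real ^ 'n ^ 'n" and d where "orthogonal_matrix Q"
    "transpose Q ** M ** Q = (\<chi> i j. if i = j then d i else 0)"
proof -
  have "\<exists>S. finite S \<and> card S = k \<and> pairwise orthogonal S \<and>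
      (\<forall>x\<in>S. norm x = 1 \<and> (\<exists>l. M *v x = l *\<^sub>R x))" if "k \<le> CARD('n)" for k
    using that
  proof (induction k)
    case 0
    show ?case by (intro exI[of _ "{}"]) simp
  next
    case (Suc k)
    then obtain S where S: "finite S" "card S = k" "pairwise orthogonal S"
      "\<And>x. x \<in> S \<Longrightarrow> norm x = 1" "\<And>x. x \<in> S \<Longrightarrow> \<exists>l. M *v x = l *\<^sub>R x"
      by auto
    define V where "V = {x. \<forall>s\<in>S. s \<bullet> x = 0}"
    have V: "subspace V"
      by (auto simp: V_def subspace_def inner_add_right)
    have "dim S \<le> k" using S dim_le_card' by blast
    then have "dim S < DIM(real ^ 'n)" using Suc.prems by simp
    then obtain x0 where x0: "x0 \<noteq> 0" "\<And>y. y \<in> span S \<Longrightarrow> orthogonal x0 y"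
      using orthogonal_to_subspace_exists by blast
    have x0V: "x0 \<in> V"
      using x0(2) by (auto simp: V_def orthogonal_def inner_commute span_base)
    have inv: "M *v x \<in> V" if "x \<in> V" for x
      unfolding V_def
    proof (intro CollectI ballI)
      fix s assume s: "s \<in> S"
      then obtain l where "M *v s = l *\<^sub>R s" using S(5) by blast
      then have "s \<bullet> (M *v x) = l * (s \<bullet> x)"
        using symmetric_form[OF sym, of s x] by simp
      then show "s \<bullet> (M *v x) = 0" using that s by (simp add: V_def)
    qed
    obtain v l where v: "v \<in> V" "norm v = 1" "M *v v = l *\<^sub>R v"
      using rayleigh_minimum_eigenvector[OF sym V x0V x0(1) inv] by metis
    have "v \<notin> S"
      using v(1,2) by (auto simp: V_def)
    then have "card (insert v S) = Suc k" using S by simp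
    moreover have "pairwise orthogonal (insert v S)"
      using S(3) v(1) by (auto simp: pairwise_insert V_def orthogonal_def inner_commute)
    ultimately show ?case
      using S v by (intro exI[of _ "insert v S"]) auto
  qed
  from this[of "CARD('n)"] obtain S where S: "finite S" "card S = CARD('n)" "pairwise orthogonal S"
      "\<And>x. x \<in> S \<Longrightarrow> norm x = 1" "\<And>x. x \<in> S \<Longrightarrow> \<exists>l. M *v x = l *\<^sub>R x"
    by auto
  obtain f where f: "bij_betw f (UNIV :: 'n set) S"
    using S finite_same_card_bij by (metis finite_class.finite_UNIV)
  have fS: "f i \<in> S" for i using f by (auto simp: bij_betw_def)
  define Q where "Q = (\<chi> i j. f j $ i)"
  have col: "column j Q = f j" for j by (simp add: column_def Q_def)
  have orth: "f i \<bullet> f j = (if i = j then 1 else 0)" for i j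
  proof (cases "i = j")
    case True
    then show ?thesis using S(4)[OF fS] by (simp add: dot_square_norm)
  next
    case False
    then have "f i \<noteq> f j" using f by (auto simp: bij_betw_def inj_def)
    then show ?thesis using S(3) fS False by (auto simp: pairwise_def orthogonal_def)
  qed
  have "\<forall>i. \<exists>l. M *v f i = l *\<^sub>R f i" using S(5) fS by blast
  from choice[OF this] obtain d where d: "\<And>i. M *v f i = d i *\<^sub>R f i" by blast
  show ?thesis
  proof
    show "orthogonal_matrix Q"
      unfolding orthogonal_matrix matrix_mult_transpose_dot_column
      by (simp add: col orth mat_def vec_eq_iff)
    show "transpose Q ** M ** Q = (\<chi> i j. if i = j then d i else 0)"
      by (simp add: vec_eq_iff congruence_entry col d orth)
  qed
qed

lemma trace_congruence_eq_sum:
  fixes M S :: "real ^ 'n ^ 'n"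
  shows "trace (transpose S ** M ** S) = (\<Sum>i\<in>UNIV. column i S \<bullet> (M *v column i S))"
  by (simp add: trace_def congruence_entry)

text \<open>The minimum of the Rayleigh quotient is an eigenvalue. The minimum over all eigenvalues is only
  meaningful because there are finitely many: eigenvectors for distinct eigenvalues are orthogonal.\<close>

lemma smallest_eigenvalue_le_form:
  fixes A :: "real ^ 'n ^ 'n"
  assumes sym: "transpose A = A"
  shows "smallest_eigenvalue A * (w \<bullet> w) \<le> w \<bullet> (A *v w)"
proof -
  obtain v l where v: "norm v = 1" "A *v v = l *\<^sub>R v"
    and low: "\<And>w. l * (w \<bullet> w) \<le> w \<bullet> (A *v w)"
    using rayleigh_minimum_eigenvector[OF sym subspace_UNIV, of "axis undefined 1"]
    by (auto simp: axis_eq_0_iff)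
  have "\<forall>c\<in>eigenvalues A. \<exists>v. v \<noteq> 0 \<and> A *v v = c *\<^sub>R v"
    by (simp add: eigenvalues_def)
  from bchoice[OF this] obtain e where e: "\<And>c. c \<in> eigenvalues A \<Longrightarrow> e c \<noteq> 0 \<and> A *v e c = c *\<^sub>R e c"
    by blast
  have orth: "orthogonal (e c) (e d)" if "c \<in> eigenvalues A" "d \<in> eigenvalues A" "c \<noteq> d" for c d
    using symmetric_form[OF sym, of "e c" "e d"] e[OF that(1)] e[OF that(2)] that(3)
    by (simp add: orthogonal_def)
  have inj: "inj_on e (eigenvalues A)"
  proof (rule inj_onI, rule ccontr)
    fix c d assume "c \<in> eigenvalues A" "d \<in> eigenvalues A" "e c = e d" "c \<noteq> d"
    then show False using orth[of c d] e[of d] by (simp add: orthogonal_def)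
  qed
  have "pairwise orthogonal (e ` eigenvalues A)"
    using orth by (auto simp: pairwise_def)
  moreover have "0 \<notin> e ` eigenvalues A" using e by auto
  ultimately have "finite (e ` eigenvalues A)"
    using pairwise_orthogonal_independent independent_imp_finite by blast
  then have "finite (eigenvalues A)" using inj by (rule finite_imageD)
  moreover have "l \<in> eigenvalues A"
    using v unfolding eigenvalues_def by (intro CollectI exI[of _ v]) auto
  ultimately have "smallest_eigenvalue A \<le> l"
    unfolding smallest_eigenvalue_def by (rule Min_le)
  then have "smallest_eigenvalue A * (w \<bullet> w) \<le> l * (w \<bullet> w)" by (rule mult_right_mono) simp
  also have "\<dots> \<le> w \<bullet> (A *v w)" by (rule low)
  finally show ?thesis .
qed

section \<open>Positive definite matrices and their inverses\<close>

lemma matrix_inv_inverse: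
  fixes A :: "real ^ 'n ^ 'n"
  assumes "det A \<noteq> 0"
  shows "A ** matrix_inv A = mat 1" "matrix_inv A ** A = mat 1"
proof -
  have "\<exists>B. A ** B = mat 1 \<and> B ** A = mat 1"
    using assms invertible_det_nz invertible_def by blast
  then have "A ** matrix_inv A = mat 1 \<and> matrix_inv A ** A = mat 1"
    unfolding matrix_inv_def by (rule someI_ex)
  then show "A ** matrix_inv A = mat 1" "matrix_inv A ** A = mat 1" by auto
qed

lemma matrix_inv_unique_real:
  fixes A B :: "real ^ 'n ^ 'n"
  assumes "A ** B = mat 1"
  shows "matrix_inv A = B"
proof -
  have "det A * det B = 1" using assms by (metis det_I det_mul)
  then have "det A \<noteq> 0" by auto
  then have "matrix_inv A ** (A ** B) = B"
    by (simp add: matrix_mul_assoc matrix_inv_inverse)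
  then show ?thesis by (simp add: assms)
qed

text \<open>Rescaling an orthonormal eigenbasis of \<open>B\<close> makes \<open>B\<close> the identity; a rotation, which
  keeps it so, then diagonalises \<open>A\<close>.\<close>

lemma simultaneous_diagonalization:
  fixes A B :: "real ^ 'n ^ 'n"
  assumes A: "transpose A = A" and B: "pos_def B"
  obtains S :: "real ^ 'n ^ 'n" and e where "transpose S ** B ** S = mat 1"
    "transpose S ** A ** S = (\<chi> i j. if i = j then e i else 0)"
proof -
  have symB: "transpose B = B" using B by (simp add: pos_def_def)
  obtain Q d where Q: "orthogonal_matrix Q"
    "transpose Q ** B ** Q = (\<chi> i j. if i = j then d i else 0)"
    by (rule spectral_theorem[OF symB])
  have Qc: "column i Q \<bullet> (B *v column j Q) = (if i = j then d i else 0)" for i j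
    using Q(2) by (simp add: congruence_entry[symmetric])
  have dpos: "d i > 0" for i
  proof -
    have "norm (column i Q) = 1"
      using Q(1) by (simp add: orthogonal_matrix_orthonormal_columns)
    then have "column i Q \<noteq> 0" by auto
    then have "0 < column i Q \<bullet> (B *v column i Q)" using B by (simp add: pos_def_def)
    then show ?thesis by (simp add: Qc)
  qed
  \<comment> \<open>The columns of \<open>T\<close> are the eigenvectors of \<open>B\<close>, scaled to be orthonormal for the form of \<open>B\<close>.\<close>
  define T where "T = (\<chi> i j. Q $ i $ j / sqrt (d j))"
  have colT: "column j T = (1 / sqrt (d j)) *\<^sub>R column j Q" for j
    by (simp add: column_def T_def vec_eq_iff)
  have TB: "transpose T ** B ** T = mat 1"
  proof -
    have "sqrt (d i) \<noteq> 0" "sqrt (d i) * sqrt (d i) = d i" for i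
      using dpos[of i] by simp_all
    then show ?thesis
      using dpos by (simp add: vec_eq_iff congruence_entry colT matrix_vector_mult_scaleR Qc mat_def)
  qed
  have "transpose (transpose T ** A ** T) = transpose T ** A ** T"
    using A by (simp add: matrix_transpose_mul matrix_mul_assoc)
  then obtain R e where R: "orthogonal_matrix R"
    "transpose R ** (transpose T ** A ** T) ** R = (\<chi> i j. if i = j then e i else 0)"
    by (rule spectral_theorem)
  show ?thesis
  proof
    show "transpose (T ** R) ** A ** (T ** R) = (\<chi> i j. if i = j then e i else 0)"
      using R(2) by (simp add: matrix_transpose_mul matrix_mul_assoc)
    have "transpose (T ** R) ** B ** (T ** R) = transpose R ** (transpose T ** B ** T) ** R"
      by (simp add: matrix_transpose_mul matrix_mul_assoc)
    then show "transpose (T ** R) ** B ** (T ** R) = mat 1"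
      using R(1) by (simp add: TB orthogonal_matrix)
  qed
qed

lemma matrix_inv_of_congruence:
  fixes B S :: "real ^ 'n ^ 'n"
  assumes "transpose S ** B ** S = mat 1"
  shows "matrix_inv B = S ** transpose S"
proof -
  have "transpose S ** (B ** S) = mat 1" using assms by (simp add: matrix_mul_assoc)
  then have "(B ** S) ** transpose S = mat 1" using matrix_left_right_inverse by blast
  then show ?thesis by (intro matrix_inv_unique_real) (simp add: matrix_mul_assoc)
qed

text \<open>Traces against the inverse of \<open>B\<close> become ordinary traces in a \<open>B\<close>-orthonormal frame \<open>S\<close>.\<close>

lemma trace_matrix_inv_mult:
  fixes B N S :: "real ^ 'n ^ 'n"
  assumes "transpose S ** B ** S = mat 1"
  shows "trace (matrix_inv B ** N) = trace (transpose S ** N ** S)"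
  unfolding matrix_inv_of_congruence[OF assms]
  using trace_mul_sym[of S "transpose S ** N"] by (simp add: matrix_mul_assoc)

lemma trace_inv_mult_psd_nonneg:
  fixes B N :: "real ^ 'n ^ 'n"
  assumes B: "pos_def B" and N: "\<And>v. 0 \<le> v \<bullet> (N *v v)"
  shows "0 \<le> trace (matrix_inv B ** N)"
proof -
  obtain S :: "real ^ 'n ^ 'n" and e where S: "transpose S ** B ** S = mat 1"
    "transpose S ** B ** S = (\<chi> i j. if i = j then e i else 0)"
    by (rule simultaneous_diagonalization[OF pos_def_symmetric[OF B] B])
  show ?thesis
    unfolding trace_matrix_inv_mult[OF S(1)] trace_congruence_eq_sum by (intro sum_nonneg N)
qed

text \<open>The tangent inequality for the concave function \<open>ln det\<close> at \<open>B\<close>. After simultaneous diagonalisation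
  it is \<open>e \<le> exp (e - 1)\<close> multiplied over the eigenvalues of \<open>B\<^sup>-\<^sup>1 A\<close>.\<close>

lemma det_le_exp_trace:
  fixes A B :: "real ^ 'n ^ 'n"
  assumes A: "pos_def A" and B: "pos_def B"
  shows "det A \<le> det B * exp (trace (matrix_inv B ** A) - real CARD('n))"
proof -
  obtain S :: "real ^ 'n ^ 'n" and e where S: "transpose S ** B ** S = mat 1"
    "transpose S ** A ** S = (\<chi> i j. if i = j then e i else 0)"
    by (rule simultaneous_diagonalization[OF pos_def_symmetric[OF A] B])
  have detB: "(det S)\<^sup>2 * det B = 1"
    using arg_cong[OF S(1), of det] by (simp add: det_mul power2_eq_square mult_ac)
  then have nz: "det S \<noteq> 0" by auto
  have epos: "e i > 0" for i
  proof -
    have "S *v axis i 1 \<noteq> 0"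
    proof
      assume "S *v axis i 1 = 0"
      moreover have "invertible S" using nz by (simp add: invertible_det_nz)
      ultimately show False
        using matrix_left_invertible_ker[of S] by (auto simp: invertible_left_inverse axis_eq_0_iff)
    qed
    then have "0 < column i S \<bullet> (A *v column i S)"
      using A by (simp add: pos_def_def matrix_vector_mult_basis)
    then show ?thesis using S(2) by (simp add: congruence_entry[symmetric])
  qed
  have detA: "(det S)\<^sup>2 * det A = (\<Prod>i\<in>UNIV. e i)"
    using arg_cong[OF S(2), of det]
    by (simp add: det_mul power2_eq_square mult_ac det_diagonal)
  have "(\<Prod>i\<in>UNIV. e i) \<le> (\<Prod>i\<in>UNIV. exp (e i - 1))"
    using epos exp_ge_add_one_self[of "e i - 1" for i]
    by (intro prod_mono) (auto simp: less_imp_le)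
  also have "\<dots> = exp ((\<Sum>i\<in>UNIV. e i) - real CARD('n))"
    by (simp add: exp_sum[symmetric] sum_subtractf)
  also have "(\<Sum>i\<in>UNIV. e i) = trace (matrix_inv B ** A)"
    unfolding trace_matrix_inv_mult[OF S(1)] S(2) by (simp add: trace_def)
  finally have "(det S)\<^sup>2 * det A \<le> ((det S)\<^sup>2 * det B) * exp (trace (matrix_inv B ** A) - real CARD('n))"
    using detA detB by simp
  then show ?thesis
    using nz by (simp add: mult.assoc)
qed

lemma pos_def_det_pos:
  fixes A :: "real ^ 'n ^ 'n"
  assumes "pos_def A"
  shows "det A > 0"
proof -
  obtain S :: "real ^ 'n ^ 'n" and e where S: "transpose S ** A ** S = mat 1"
    "transpose S ** A ** S = (\<chi> i j. if i = j then e i else 0)"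
    by (rule simultaneous_diagonalization[OF pos_def_symmetric[OF assms] assms])
  have "(det S)\<^sup>2 * det A = 1"
    using arg_cong[OF S(1), of det] by (simp add: det_mul power2_eq_square mult_ac)
  then have "0 < (det S)\<^sup>2 * det A" by simp
  then show ?thesis by (simp add: zero_less_mult_iff)
qed

lemma pos_def_matrix_inv:
  fixes A :: "real ^ 'n ^ 'n"
  assumes "pos_def A"
  shows "pos_def (matrix_inv A)"
proof -
  have sym: "transpose A = A" using assms by (simp add: pos_def_def)
  have d: "det A \<noteq> 0" using pos_def_det_pos[OF assms] by simp
  have "A ** transpose (matrix_inv A) = mat 1"
    using arg_cong[OF matrix_inv_inverse(2)[OF d], of transpose] sym
    by (simp add: matrix_transpose_mul)
  from matrix_inv_unique_real[OF this]
  have symI: "transpose (matrix_inv A) = matrix_inv A" by simp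
  have "0 < v \<bullet> (matrix_inv A *v v)" if "v \<noteq> 0" for v
  proof -
    define w where "w = matrix_inv A *v v"
    have v: "v = A *v w" by (simp add: w_def matrix_vector_mul_assoc matrix_inv_inverse d)
    then have "w \<noteq> 0" using that by auto
    then have "0 < w \<bullet> (A *v w)" using assms by (simp add: pos_def_def)
    then show ?thesis using v by (metis w_def inner_commute)
  qed
  with symI show ?thesis by (simp add: pos_def_def)
qed

text \<open>With \<open>w = A\<^sup>-\<^sup>1 v\<close> the claim is \<open>m (v \<bullet> w) \<le> v \<bullet> v\<close>, which follows by expanding
  \<open>|v - m w|\<^sup>2 \<ge> 0\<close> and using the lower bound at \<open>w\<close>.\<close>

lemma matrix_inv_form_upper:
  fixes A :: "real ^ 'n ^ 'n"
  assumes A: "pos_def A" and m: "m > 0" and low: "\<And>w. m * (w \<bullet> w) \<le> w \<bullet> (A *v w)"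
  shows "v \<bullet> (matrix_inv A *v v) \<le> (v \<bullet> v) / m"
proof -
  define w where "w = matrix_inv A *v v"
  have "det A \<noteq> 0" using pos_def_det_pos[OF A] by simp
  then have v: "A *v w = v" by (simp add: w_def matrix_vector_mul_assoc matrix_inv_inverse)
  have 1: "m * (w \<bullet> w) \<le> v \<bullet> w" using low[of w] by (simp add: v inner_commute)
  have "0 \<le> (v - m *\<^sub>R w) \<bullet> (v - m *\<^sub>R w)" by simp
  also have "\<dots> = v \<bullet> v - 2 * m * (v \<bullet> w) + m * (m * (w \<bullet> w))"
    by (simp add: inner_diff inner_commute algebra_simps)
  also have "\<dots> \<le> v \<bullet> v - 2 * m * (v \<bullet> w) + m * (v \<bullet> w)"
    using 1 m by (intro add_left_mono mult_left_mono) auto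
  finally have "m * (v \<bullet> w) \<le> v \<bullet> v" by simp
  then show ?thesis using m by (simp add: w_def field_simps)
qed

text \<open>The trace in an orthonormal basis containing \<open>e\<close>, with every other diagonal entry at most \<open>K\<close>.
  Keeping the entry along \<open>e\<close> exact is what yields \<open>n - 1\<close> instead of \<open>n\<close> in the growth condition.\<close>

lemma trace_le_direction:
  fixes C :: "real ^ 'n ^ 'n"
  assumes up: "\<And>v. v \<bullet> (C *v v) \<le> K * (v \<bullet> v)" and e: "norm e = 1"
  shows "trace C \<le> e \<bullet> (C *v e) + (real CARD('n) - 1) * K"
proof -
  define k where "k = (undefined :: 'n)"
  obtain R where R: "orthogonal_matrix R" "R *v axis k 1 = e"
    using orthogonal_matrix_exists_basis[OF e] by blast
  have "trace C = trace (transpose R ** C ** R)"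
    using R(1) trace_mul_sym[of "transpose R" "C ** R"]
    by (simp add: orthogonal_matrix_def flip: matrix_mul_assoc)
  also have "\<dots> = column k R \<bullet> (C *v column k R) +
      (\<Sum>i\<in>UNIV - {k}. column i R \<bullet> (C *v column i R))"
    unfolding trace_congruence_eq_sum by (rule sum.remove) auto
  also have "column k R = e" using R(2) by (simp add: matrix_vector_mult_basis)
  also have "(\<Sum>i\<in>UNIV - {k}. column i R \<bullet> (C *v column i R)) \<le> (\<Sum>i\<in>UNIV - {k}. K)"
  proof (rule sum_mono)
    fix i
    have "norm (column i R) = 1" using R(1) by (simp add: orthogonal_matrix_orthonormal_columns)
    then show "column i R \<bullet> (C *v column i R) \<le> K"
      using up[of "column i R"] by (simp add: dot_square_norm)
  qed
  also have "\<dots> = (real CARD('n) - 1) * K"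
    by (simp add: card_Diff_singleton of_nat_diff Suc_leI)
  finally show ?thesis by simp
qed

definition outer :: "real ^ 'n \<Rightarrow> real ^ 'n ^ 'n" where
  "outer v = (\<chi> i j. v $ i * v $ j)"

lemma outer_mult_vec: "outer v *v w = (v \<bullet> w) *\<^sub>R v"
  by (simp add: outer_def matrix_vector_mult_def inner_vec_def vec_eq_iff sum_distrib_left
      mult_ac)

text \<open>Hessians of radial functions have this shape.\<close>

lemma trace_mult_rank_one_update:
  fixes C :: "real ^ 'n ^ 'n"
  shows "trace (C ** (a *\<^sub>R mat 1 + b *\<^sub>R outer v)) = a * trace C + b * (v \<bullet> (C *v v))"
proof -
  have "C ** (a *\<^sub>R mat 1 + b *\<^sub>R outer v) = a *\<^sub>R C + b *\<^sub>R (C ** outer v)"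
    by (simp add: matrix_add_ldistrib matrix_scalar_ac scalar_matrix_assoc)
  then have "trace (C ** (a *\<^sub>R mat 1 + b *\<^sub>R outer v)) = a * trace C + b * trace (C ** outer v)"
    by (simp add: trace_def sum.distrib sum_distrib_left)
  also have "trace (C ** outer v) = v \<bullet> (C *v v)"
    by (simp add: trace_def matrix_matrix_mult_def outer_def matrix_vector_mult_def inner_vec_def
        sum_distrib_left mult_ac)
  finally show ?thesis .
qed

section \<open>Continuity of matrix operations\<close>

lemma tendsto_det:
  fixes X :: "'a \<Rightarrow> real ^ 'n ^ 'n"
  assumes "(X \<longlongrightarrow> A) F"
  shows "((\<lambda>k. det (X k)) \<longlongrightarrow> det A) F"
  unfolding det_def
  by (intro tendsto_sum tendsto_mult tendsto_const tendsto_prod tendsto_vec_nth assms)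

text \<open>Cramer's rule exhibits the entries of the inverse as quotients of determinants, hence as continuous
  functions of the matrix.\<close>

lemma matrix_inv_cramer:
  fixes A :: "real ^ 'n ^ 'n"
  assumes "det A \<noteq> 0"
  shows "matrix_inv A =
    (\<chi> k l. det (\<chi> i j. if j = k then axis l 1 $ i else A $ i $ j) / det A)"
proof -
  have "A *v (matrix_inv A *v axis l 1) = axis l 1" for l
    by (simp add: matrix_vector_mul_assoc matrix_inv_inverse assms)
  then have "column l (matrix_inv A) =
      (\<chi> k. det (\<chi> i j. if j = k then axis l 1 $ i else A $ i $ j) / det A)" for l
    unfolding cramer[OF assms] by (simp add: matrix_vector_mult_basis)
  then show ?thesis by (simp add: column_def vec_eq_iff)
qed

lemma tendsto_matrix_inv:
  fixes X :: "'a \<Rightarrow> real ^ 'n ^ 'n"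
  assumes X: "(X \<longlongrightarrow> A) F" and d: "det A \<noteq> 0" "\<And>k. det (X k) \<noteq> 0"
  shows "((\<lambda>k. matrix_inv (X k)) \<longlongrightarrow> matrix_inv A) F"
  unfolding matrix_inv_cramer[OF d(1)] matrix_inv_cramer[OF d(2)]
proof (intro tendsto_vec_lambda tendsto_divide tendsto_det X d(1))
  fix k l i j
  show "((\<lambda>x. if j = k then axis l 1 $ i else X x $ i $ j) \<longlongrightarrow>
      (if j = k then axis l 1 $ i else A $ i $ j)) F"
    using tendsto_vec_nth[OF tendsto_vec_nth[OF X]] by (cases "j = k") auto
qed

lemma tendsto_trace_mult:
  fixes X Y :: "'a \<Rightarrow> real ^ 'n ^ 'n"
  assumes "(X \<longlongrightarrow> A) F" "(Y \<longlongrightarrow> B) F"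
  shows "((\<lambda>k. trace (X k ** Y k)) \<longlongrightarrow> trace (A ** B)) F"
  unfolding trace_def matrix_matrix_mult_def vec_lambda_beta
  by (intro tendsto_sum tendsto_mult tendsto_vec_nth assms)

lemma tendsto_matrix_vector:
  fixes X :: "'a \<Rightarrow> real ^ 'n ^ 'm"
  assumes "(X \<longlongrightarrow> A) F" "(y \<longlongrightarrow> b) F"
  shows "((\<lambda>k. X k *v y k) \<longlongrightarrow> A *v b) F"
  unfolding matrix_vector_mult_def
  by (intro tendsto_vec_lambda tendsto_sum tendsto_mult tendsto_vec_nth assms)

section \<open>Functions with gradient and Hessian\<close>

text \<open>A twice differentiable function together with explicit gradient and Hessian fields. With the
  fields as parameters, test functions can be added, scaled and dilated without returning to partial
  derivatives.\<close>

definition grad_hess :: "(real ^ 'n \<Rightarrow> real) \<Rightarrow> (real ^ 'n \<Rightarrow> real ^ 'n) \<Rightarrow> (real ^ 'n \<Rightarrow> real ^ 'n ^ 'n) \<Rightarrow> bool" where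
  "grad_hess f g P \<longleftrightarrow>
     (\<forall>x. (f has_derivative (\<lambda>v. g x \<bullet> v)) (at x)) \<and>
     (\<forall>x. (g has_derivative (\<lambda>v. P x *v v)) (at x)) \<and>
     continuous_on UNIV P"

lemma grad_hess_gradient:
  "grad_hess f g P \<Longrightarrow> (f has_derivative (\<lambda>v. g x \<bullet> v)) (at x)"
  by (simp add: grad_hess_def)

lemma grad_hess_hessian:
  "grad_hess f g P \<Longrightarrow> (g has_derivative (\<lambda>v. P x *v v)) (at x)"
  by (simp add: grad_hess_def)

lemma grad_hess_tendsto:
  assumes "grad_hess f g P" "(X \<longlongrightarrow> x) F"
  shows "((\<lambda>k. f (X k)) \<longlongrightarrow> f x) F" "((\<lambda>k. g (X k)) \<longlongrightarrow> g x) F" "((\<lambda>k. P (X k)) \<longlongrightarrow> P x) F"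
proof -
  have "isCont f x" "isCont g x" "isCont P x"
    using assms(1) has_derivative_continuous unfolding grad_hess_def
    by (blast, blast, simp add: continuous_on_eq_continuous_at)
  then show "((\<lambda>k. f (X k)) \<longlongrightarrow> f x) F" "((\<lambda>k. g (X k)) \<longlongrightarrow> g x) F" "((\<lambda>k. P (X k)) \<longlongrightarrow> P x) F"
    using assms(2) isCont_tendsto_compose by blast+
qed

lemma grad_hess_add:
  assumes "grad_hess f g P" "grad_hess f' g' P'"
  shows "grad_hess (\<lambda>x. f x + f' x) (\<lambda>x. g x + g' x) (\<lambda>x. P x + P' x)"
  unfolding grad_hess_def
proof (intro conjI allI)
  fix x
  show "((\<lambda>x. f x + f' x) has_derivative (\<lambda>v. (g x + g' x) \<bullet> v)) (at x)"
    unfolding inner_add_left by (intro has_derivative_add grad_hess_gradient[OF assms(1)]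
        grad_hess_gradient[OF assms(2)])
  show "((\<lambda>x. g x + g' x) has_derivative (\<lambda>v. (P x + P' x) *v v)) (at x)"
    unfolding matrix_vector_mult_add_rdistrib by (intro has_derivative_add
        grad_hess_hessian[OF assms(1)] grad_hess_hessian[OF assms(2)])
  show "continuous_on UNIV (\<lambda>x. P x + P' x)"
    using assms by (auto simp: grad_hess_def intro: continuous_intros)
qed

lemma grad_hess_cmult:
  assumes "grad_hess f g P"
  shows "grad_hess (\<lambda>x. c * f x) (\<lambda>x. c *\<^sub>R g x) (\<lambda>x. c *\<^sub>R P x)"
  unfolding grad_hess_def
proof (intro conjI allI)
  fix x
  show "((\<lambda>x. c * f x) has_derivative (\<lambda>v. (c *\<^sub>R g x) \<bullet> v)) (at x)"
    unfolding inner_scaleR_left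
    by (intro has_derivative_mult_right grad_hess_gradient[OF assms])
  show "((\<lambda>x. c *\<^sub>R g x) has_derivative (\<lambda>v. (c *\<^sub>R P x) *v v)) (at x)"
    unfolding scaleR_matrix_vector_assoc[symmetric]
    by (intro has_derivative_scaleR_right grad_hess_hessian[OF assms])
  show "continuous_on UNIV (\<lambda>x. c *\<^sub>R P x)"
    using assms by (auto simp: grad_hess_def intro: continuous_intros)
qed

lemma grad_hess_linear: "grad_hess (\<lambda>x. a \<bullet> x) (\<lambda>x. a) (\<lambda>x. 0)"
  unfolding grad_hess_def by (auto intro!: derivative_eq_intros)

text \<open>The factor \<open>1 / l\<^sup>2\<close> is chosen so that the Hessian is merely transported, not scaled.\<close>

lemma grad_hess_dilation:
  assumes "grad_hess f g P" and l: "l \<noteq> 0"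
  shows "grad_hess (\<lambda>x. f (l *\<^sub>R x) / l\<^sup>2) (\<lambda>x. (1 / l) *\<^sub>R g (l *\<^sub>R x)) (\<lambda>x. P (l *\<^sub>R x))"
  unfolding grad_hess_def
proof (intro conjI allI)
  fix x
  have "((\<lambda>x. f (l *\<^sub>R x)) has_derivative (\<lambda>v. g (l *\<^sub>R x) \<bullet> (l *\<^sub>R v))) (at x)"
    by (rule has_derivative_compose[OF _ grad_hess_gradient[OF assms(1)]])
      (auto intro!: derivative_eq_intros)
  from has_derivative_mult_right[OF this, of "1 / l\<^sup>2"]
  show "((\<lambda>x. f (l *\<^sub>R x) / l\<^sup>2) has_derivative (\<lambda>v. (1 / l) *\<^sub>R g (l *\<^sub>R x) \<bullet> v)) (at x)"
    using l by (simp add: power2_eq_square)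
  have "((\<lambda>x. g (l *\<^sub>R x)) has_derivative (\<lambda>v. P (l *\<^sub>R x) *v (l *\<^sub>R v))) (at x)"
    by (rule has_derivative_compose[OF _ grad_hess_hessian[OF assms(1)]])
      (auto intro!: derivative_eq_intros)
  from has_derivative_scaleR_right[OF this, of "1 / l"]
  show "((\<lambda>x. (1 / l) *\<^sub>R g (l *\<^sub>R x)) has_derivative (\<lambda>v. P (l *\<^sub>R x) *v v)) (at x)"
    using l by (simp add: matrix_vector_mult_scaleR)
  show "continuous_on UNIV (\<lambda>x. P (l *\<^sub>R x))"
    using assms(1) unfolding grad_hess_def
    by (auto intro!: continuous_on_compose2[of UNIV P] continuous_intros)
qed

lemma grad_hess_radial:
  fixes p :: "real ^ 'n"
  assumes F: "\<And>s. s \<ge> 0 \<Longrightarrow> (F has_real_derivative F' s) (at s)"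
    and F': "\<And>s. s \<ge> 0 \<Longrightarrow> (F' has_real_derivative F'' s) (at s)"
    and F'': "continuous_on {0..} F''"
  defines "r \<equiv> \<lambda>x. (x - p) \<bullet> (x - p)"
  shows "grad_hess (\<lambda>x. F (r x)) (\<lambda>x. (2 * F' (r x)) *\<^sub>R (x - p))
    (\<lambda>x. (2 * F' (r x)) *\<^sub>R mat 1 + (4 * F'' (r x)) *\<^sub>R outer (x - p))"
proof -
  have r: "(r has_derivative (\<lambda>v. 2 * ((x - p) \<bullet> v))) (at x)" for x
    unfolding r_def by (auto intro!: derivative_eq_intros simp: inner_commute)
  have comp: "((\<lambda>x. G (r x)) has_derivative (\<lambda>v. 2 * G' (r x) * ((x - p) \<bullet> v))) (at x)"
    if "\<And>s. s \<ge> 0 \<Longrightarrow> (G has_real_derivative G' s) (at s)" for G G' x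
  proof -
    have "r x \<ge> 0" by (simp add: r_def)
    then have "(G has_derivative (\<lambda>y. G' (r x) * y)) (at (r x))"
      using that by (simp add: has_field_derivative_def)
    from has_derivative_compose[OF r this] show ?thesis by (simp add: mult_ac)
  qed
  have cF': "continuous_on {0..} F'"
    using F' by (intro continuous_at_imp_continuous_on ballI DERIV_isCont) auto
  have cr: "continuous_on UNIV r"
    unfolding r_def by (intro continuous_intros)
  have couter: "continuous_on UNIV (\<lambda>x. outer (x - p))"
    unfolding outer_def by (intro continuous_intros)
  show ?thesis
    unfolding grad_hess_def
  proof (intro conjI allI)
    fix x
    show "((\<lambda>x. F (r x)) has_derivative (\<lambda>v. (2 * F' (r x)) *\<^sub>R (x - p) \<bullet> v)) (at x)"
      using comp[OF F] by simp
    have "((\<lambda>x. 2 * F' (r x)) has_derivative (\<lambda>v. 2 * (2 * F'' (r x) * ((x - p) \<bullet> v)))) (at x)"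
      by (rule has_derivative_mult_right) (rule comp[OF F'])
    moreover have "((\<lambda>x. x - p) has_derivative (\<lambda>v. v)) (at x)"
      by (auto intro!: derivative_eq_intros)
    ultimately have "((\<lambda>x. (2 * F' (r x)) *\<^sub>R (x - p)) has_derivative
        (\<lambda>v. (2 * F' (r x)) *\<^sub>R v + (2 * (2 * F'' (r x) * ((x - p) \<bullet> v))) *\<^sub>R (x - p))) (at x)"
      by (rule has_derivative_scaleR)
    then show "((\<lambda>x. (2 * F' (r x)) *\<^sub>R (x - p)) has_derivative
        (\<lambda>v. ((2 * F' (r x)) *\<^sub>R mat 1 + (4 * F'' (r x)) *\<^sub>R outer (x - p)) *v v)) (at x)"
      by (simp add: matrix_vector_mult_add_rdistrib outer_mult_vec mult_ac
          flip: scaleR_matrix_vector_assoc)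
    show "continuous_on UNIV (\<lambda>x. (2 * F' (r x)) *\<^sub>R mat 1 + (4 * F'' (r x)) *\<^sub>R outer (x - p))"
      by (intro continuous_intros couter continuous_on_compose2[OF cF' cr]
          continuous_on_compose2[OF F'' cr]) (auto simp: r_def)
  qed
qed

lemma line_derivative:
  assumes "\<And>x. (f has_derivative (\<lambda>v. g x \<bullet> v)) (at x)"
  shows "((\<lambda>s. f (y + s *\<^sub>R a)) has_real_derivative g (y + s *\<^sub>R a) \<bullet> a) (at s)"
proof -
  have "((\<lambda>s. y + s *\<^sub>R a) has_derivative (\<lambda>h. h *\<^sub>R a)) (at s)"
    by (auto intro!: derivative_eq_intros)
  from has_derivative_compose[OF this assms]
  have "((\<lambda>s. f (y + s *\<^sub>R a)) has_derivative (\<lambda>h. (g (y + s *\<^sub>R a) \<bullet> a) * h)) (at s)"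
    by (simp add: mult.commute)
  then show ?thesis unfolding has_field_derivative_def .
qed

text \<open>The mean value theorem in the direction \<open>a\<close> expresses the second difference through the
  increment of \<open>g\<close> between two points within \<open>t (|a| + |b|)\<close> of \<open>x\<close>, and differentiability of \<open>g\<close> at \<open>x\<close>
  alone linearises that increment.\<close>

lemma second_difference_estimate:
  fixes f :: "'a :: real_inner \<Rightarrow> real"
  assumes f: "\<And>x. (f has_derivative (\<lambda>v. g x \<bullet> v)) (at x)"
    and g: "(g has_derivative L) (at x)" and e: "0 < e"
  shows "eventually (\<lambda>t. \<bar>(f (x + t *\<^sub>R a + t *\<^sub>R b) - f (x + t *\<^sub>R a) - f (x + t *\<^sub>R b) + f x)
      - t\<^sup>2 * (L b \<bullet> a)\<bar> \<le> e * t\<^sup>2) (at_right 0)"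
proof -
  define K where "K = norm a + norm b"
  \<comment> \<open>The summand \<open>1\<close> keeps the denominator positive if \<open>a\<close> or \<open>b\<close> vanishes.\<close>
  define \<eta> where "\<eta> = e / (2 * norm a * K + 1)"
  have K: "K \<ge> 0" by (simp add: K_def)
  then have \<eta>: "\<eta> > 0" using e by (simp add: \<eta>_def add_nonneg_pos)
  have \<eta>e: "\<eta> * (2 * norm a * K) \<le> e"
  proof -
    have "\<eta> * (2 * norm a * K) \<le> \<eta> * (2 * norm a * K + 1)" using \<eta> by simp
    also have "\<dots> = e"
    proof -
      have "2 * norm a * K + 1 > 0" using K by (simp add: add_nonneg_pos)
      then show ?thesis by (simp add: \<eta>_def)
    qed
    finally show ?thesis .
  qed
  have lin: "linear L" using g by (rule has_derivative_linear)
  obtain d where d: "d > 0"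
    "\<And>y. norm (y - x) < d \<Longrightarrow> norm (g y - g x - L (y - x)) \<le> \<eta> * norm (y - x)"
    using g \<eta> unfolding has_derivative_at_alt by blast
  have est: "\<bar>(f (x + t *\<^sub>R a + t *\<^sub>R b) - f (x + t *\<^sub>R a) - f (x + t *\<^sub>R b) + f x)
      - t\<^sup>2 * (L b \<bullet> a)\<bar> \<le> e * t\<^sup>2" if t: "0 < t" "t < d / (K + 1)" for t
  proof -
    have tK: "t * K < d"
    proof -
      have "t * K \<le> t * (K + 1)" using t by simp
      also have "\<dots> < d" using t K by (simp add: pos_less_divide_eq)
      finally show ?thesis .
    qed
    define q where "q s = f ((x + t *\<^sub>R b) + s *\<^sub>R a) - f (x + s *\<^sub>R a)" for s
    have "(q has_real_derivative g ((x + t *\<^sub>R b) + s *\<^sub>R a) \<bullet> a - g (x + s *\<^sub>R a) \<bullet> a) (at s)" for s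
      unfolding q_def by (intro DERIV_diff line_derivative f)
    from MVT2[OF t(1) this] obtain s where s: "0 < s" "s < t"
      "q t - q 0 = (t - 0) * (g ((x + t *\<^sub>R b) + s *\<^sub>R a) \<bullet> a - g (x + s *\<^sub>R a) \<bullet> a)"
      by blast
    define y1 y2 where "y1 = (x + t *\<^sub>R b) + s *\<^sub>R a" and "y2 = x + s *\<^sub>R a"
    have sa: "norm (s *\<^sub>R a) \<le> t * norm a"
      using s by (simp add: mult_right_mono)
    then have n2: "norm (y2 - x) \<le> t * K"
      using t by (simp add: y2_def K_def distrib_left add_increasing2)
    have "norm (y1 - x) \<le> norm (t *\<^sub>R b) + norm (s *\<^sub>R a)"
      using norm_triangle_ineq[of "t *\<^sub>R b" "s *\<^sub>R a"] by (simp add: y1_def)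
    then have n1: "norm (y1 - x) \<le> t * K"
      using sa t by (simp add: K_def distrib_left)
    define r where "r y = g y - g x - L (y - x)" for y
    have r: "norm (r y) \<le> \<eta> * (t * K)" if "norm (y - x) \<le> t * K" for y
    proof -
      have "norm (r y) \<le> \<eta> * norm (y - x)" unfolding r_def using d(2) that tK by simp
      also have "\<dots> \<le> \<eta> * (t * K)" using that \<eta> by simp
      finally show ?thesis .
    qed
    have "L (y1 - x) - L (y2 - x) = t *\<^sub>R L b"
      using linear_diff[OF lin, of "y1 - x" "y2 - x"] linear_scale[OF lin]
      by (simp add: y1_def y2_def)
    then have gd: "g y1 - g y2 = t *\<^sub>R L b + (r y1 - r y2)"
      unfolding r_def by (simp add: algebra_simps)
    have "(f (x + t *\<^sub>R a + t *\<^sub>R b) - f (x + t *\<^sub>R a) - f (x + t *\<^sub>R b) + f x) = q t - q 0"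
      by (simp add: q_def algebra_simps)
    also have "\<dots> = t * ((g y1 - g y2) \<bullet> a)"
      using s by (simp add: y1_def y2_def inner_diff_left)
    also have "\<dots> = t\<^sup>2 * (L b \<bullet> a) + t * ((r y1 - r y2) \<bullet> a)"
      by (simp add: gd inner_add_left algebra_simps power2_eq_square)
    finally have "\<bar>(f (x + t *\<^sub>R a + t *\<^sub>R b) - f (x + t *\<^sub>R a) - f (x + t *\<^sub>R b) + f x)
      - t\<^sup>2 * (L b \<bullet> a)\<bar> = t * \<bar>(r y1 - r y2) \<bullet> a\<bar>" using t by (simp add: abs_mult)
    also have "\<dots> \<le> t * (norm (r y1 - r y2) * norm a)"
      using t by (intro mult_left_mono Cauchy_Schwarz_ineq2) auto
    also have "\<dots> \<le> t * ((2 * (\<eta> * (t * K))) * norm a)"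
      using t r[OF n1] r[OF n2] norm_triangle_ineq4[of "r y1" "r y2"]
      by (intro mult_left_mono mult_right_mono) auto
    also have "\<dots> = (\<eta> * (2 * norm a * K)) * t\<^sup>2" by (simp add: power2_eq_square)
    also have "\<dots> \<le> e * t\<^sup>2" by (intro mult_right_mono \<eta>e) simp
    finally show ?thesis .
  qed
  moreover have "d / (K + 1) > 0" using d K by simp
  ultimately show ?thesis
    unfolding eventually_at_right_field by blast
qed

text \<open>The second difference is symmetric in \<open>a\<close> and \<open>b\<close>, and it determines both mixed derivatives up to
  \<open>o(t\<^sup>2)\<close>.\<close>

lemma second_derivative_symmetric:
  fixes f :: "'a :: real_inner \<Rightarrow> real"
  assumes f: "\<And>x. (f has_derivative (\<lambda>v. g x \<bullet> v)) (at x)"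
    and g: "(g has_derivative L) (at x)"
  shows "L b \<bullet> a = L a \<bullet> b"
proof (rule ccontr)
  assume ne: "L b \<bullet> a \<noteq> L a \<bullet> b"
  define e where "e = \<bar>L b \<bullet> a - L a \<bullet> b\<bar> / 3"
  have e: "e > 0" using ne by (simp add: e_def)
  let ?D = "\<lambda>t a b. f (x + t *\<^sub>R a + t *\<^sub>R b) - f (x + t *\<^sub>R a) - f (x + t *\<^sub>R b) + f x"
  have "eventually (\<lambda>t. \<bar>?D t a b - t\<^sup>2 * (L b \<bullet> a)\<bar> \<le> e * t\<^sup>2 \<and>
      \<bar>?D t b a - t\<^sup>2 * (L a \<bullet> b)\<bar> \<le> e * t\<^sup>2 \<and> 0 < t) (at_right 0)"
    by (intro eventually_conj second_difference_estimate[OF f g e] eventually_at_right_less)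
  then obtain t where t: "\<bar>?D t a b - t\<^sup>2 * (L b \<bullet> a)\<bar> \<le> e * t\<^sup>2"
      "\<bar>?D t b a - t\<^sup>2 * (L a \<bullet> b)\<bar> \<le> e * t\<^sup>2" "0 < t"
    using eventually_happens'[OF trivial_limit_at_right_real] by blast
  have "?D t b a = ?D t a b" by (simp add: algebra_simps)
  then have "\<bar>t\<^sup>2 * (L b \<bullet> a) - t\<^sup>2 * (L a \<bullet> b)\<bar> \<le> 2 * (e * t\<^sup>2)" using t by linarith
  moreover have "\<bar>t\<^sup>2 * (L b \<bullet> a) - t\<^sup>2 * (L a \<bullet> b)\<bar> = t\<^sup>2 * \<bar>L b \<bullet> a - L a \<bullet> b\<bar>"
    by (simp add: abs_mult flip: right_diff_distrib)
  ultimately have "t\<^sup>2 * \<bar>L b \<bullet> a - L a \<bullet> b\<bar> \<le> t\<^sup>2 * (2 * e)" by (simp add: mult_ac)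
  then have "\<bar>L b \<bullet> a - L a \<bullet> b\<bar> \<le> 2 * e" using t(3) by simp
  then show False using e by (simp add: e_def)
qed

lemma grad_hess_symmetric:
  assumes "grad_hess f g P"
  shows "transpose (P x) = P x"
proof -
  have "P x $ i $ j = P x $ j $ i" for i j
    using second_derivative_symmetric[OF grad_hess_gradient[OF assms] grad_hess_hessian[OF assms],
        where x = x and a = "axis i 1" and b = "axis j 1"]
    by (simp add: matrix_vector_mult_basis inner_axis column_def)
  then show ?thesis by (simp add: transpose_def vec_eq_iff)
qed

lemma gradient_zero_at_min:
  assumes f: "(f has_derivative (\<lambda>v. g \<bullet> v)) (at z)"
    and r: "0 < r" and min: "\<And>y. y \<in> ball z r \<Longrightarrow> f z \<le> f y"
  shows "g = 0"
proof -
  have "(\<lambda>v. g \<bullet> v) = (\<lambda>v. 0)"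
    using r min by (intro differential_zero_maxmin[of z "ball z r" f]) (auto intro: f)
  then have "g \<bullet> g = 0" by meson
  then show ?thesis by simp
qed

text \<open>Were the second derivative along \<open>v\<close> negative, the derivative along \<open>v\<close>, which is zero at the
  minimum, would be negative just after it, and the function would decrease there.\<close>

lemma hessian_psd_at_min:
  assumes C2: "grad_hess f g P" and r: "0 < r"
    and min: "\<And>y. y \<in> ball z r \<Longrightarrow> f z \<le> f y"
  shows "0 \<le> v \<bullet> (P z *v v)"
proof (rule ccontr)
  assume neg: "\<not> 0 \<le> v \<bullet> (P z *v v)"
  have v0: "v \<noteq> 0" using neg by auto
  have gz: "g z = 0"
    using gradient_zero_at_min[OF grad_hess_gradient[OF C2] r min] .
  have "((\<lambda>t. z + t *\<^sub>R v) has_derivative (\<lambda>h. h *\<^sub>R v)) (at 0)"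
    by (auto intro!: derivative_eq_intros)
  moreover have "(g has_derivative (\<lambda>v. P z *v v)) (at (z + 0 *\<^sub>R v))"
    using grad_hess_hessian[OF C2] by simp
  ultimately have "((\<lambda>t. g (z + t *\<^sub>R v)) has_derivative (\<lambda>h. P z *v (h *\<^sub>R v))) (at 0)"
    by (rule has_derivative_compose)
  then have "((\<lambda>t. g (z + t *\<^sub>R v) \<bullet> v) has_derivative (\<lambda>h. (P z *v (h *\<^sub>R v)) \<bullet> v)) (at 0)"
    by (rule has_derivative_inner_left)
  then have "((\<lambda>t. g (z + t *\<^sub>R v) \<bullet> v) has_derivative (\<lambda>h. (v \<bullet> (P z *v v)) * h)) (at 0)"
    by (simp add: matrix_vector_mult_scaleR inner_commute mult.commute)
  then have "((\<lambda>t. g (z + t *\<^sub>R v) \<bullet> v) has_real_derivative v \<bullet> (P z *v v)) (at 0)"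
    unfolding has_field_derivative_def .
  from DERIV_neg_dec_right[OF this] neg obtain d where d: "d > 0"
    "\<And>h. 0 < h \<Longrightarrow> h < d \<Longrightarrow> g (z + h *\<^sub>R v) \<bullet> v < 0"
    using gz by (auto simp: not_le)
  define t where "t = min (d / 2) (r / (2 * norm v))"
  have t: "t > 0" "t < d" using d r v0 by (auto simp: t_def)
  have "t * norm v \<le> r / (2 * norm v) * norm v" by (intro mult_right_mono) (auto simp: t_def)
  also have "\<dots> < r" using r v0 by simp
  finally have "z + t *\<^sub>R v \<in> ball z r" using t by (simp add: dist_norm)
  then have "f z \<le> f (z + t *\<^sub>R v)" by (rule min)
  moreover obtain s where "0 < s" "s < t"
    "f (z + t *\<^sub>R v) - f (z + 0 *\<^sub>R v) = (t - 0) * (g (z + s *\<^sub>R v) \<bullet> v)"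
    using MVT2[OF t(1), of "\<lambda>s. f (z + s *\<^sub>R v)" "\<lambda>s. g (z + s *\<^sub>R v) \<bullet> v"]
      line_derivative[OF grad_hess_gradient[OF C2]] by blast
  ultimately have "0 \<le> t * (g (z + s *\<^sub>R v) \<bullet> v)" by simp
  then show False using d(2)[of s] \<open>0 < s\<close> \<open>s < t\<close> t by (simp add: zero_le_mult_iff)
qed

text \<open>A convex function lies above its tangent, so subtracting the tangent creates a minimum at \<open>x\<close>
  without changing the Hessian.\<close>

lemma convex_hessian_psd:
  assumes C2: "grad_hess u g H" and conv: "strictly_convex u"
  shows "0 \<le> v \<bullet> (H x *v v)"
proof -
  have tangent: "u x + g x \<bullet> (y - x) \<le> u y" for y
  proof (cases "y = x")
    case False
    have "((\<lambda>t. (u (x + t *\<^sub>R (y - x)) - u x) / t) \<longlongrightarrow> g x \<bullet> (y - x)) (at_right 0)"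
    proof -
      have "((\<lambda>s. u (x + s *\<^sub>R (y - x))) has_real_derivative g x \<bullet> (y - x)) (at 0)"
        using line_derivative[OF grad_hess_gradient[OF C2], of x "y - x" 0] by simp
      then have "((\<lambda>t. (u (x + t *\<^sub>R (y - x)) - u x) / t) \<longlongrightarrow> g x \<bullet> (y - x)) (at 0)"
        by (simp add: DERIV_def)
      then show ?thesis by (rule filterlim_mono) (auto simp: at_le)
    qed
    moreover have "eventually (\<lambda>t. (u (x + t *\<^sub>R (y - x)) - u x) / t \<le> u y - u x) (at_right 0)"
    proof -
      have "(u (x + t *\<^sub>R (y - x)) - u x) / t \<le> u y - u x" if t: "0 < t" "t < 1" for t
      proof -
        have "u ((1 - t) *\<^sub>R x + t *\<^sub>R y) < (1 - t) * u x + t * u y"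
          using conv False t by (simp add: strictly_convex_def)
        also have "(1 - t) *\<^sub>R x + t *\<^sub>R y = x + t *\<^sub>R (y - x)" by (simp add: algebra_simps)
        finally show ?thesis using t by (simp add: field_simps)
      qed
      then show ?thesis unfolding eventually_at_right_field by (intro exI[of _ 1]) auto
    qed
    ultimately have "g x \<bullet> (y - x) \<le> u y - u x"
      by (intro tendsto_upperbound) auto
    then show ?thesis by simp
  qed simp
  have "grad_hess (\<lambda>y. u y + (- g x) \<bullet> y) (\<lambda>y. g y + (- g x)) (\<lambda>y. H y + 0)"
    by (rule grad_hess_add[OF C2 grad_hess_linear])
  moreover have "u x + (- g x) \<bullet> x \<le> u y + (- g x) \<bullet> y" for y
    using tangent[of y] by (simp add: inner_diff_right)
  ultimately have "0 \<le> v \<bullet> ((H x + 0) *v v)"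
    by (intro hessian_psd_at_min[where r = 1]) auto
  then show ?thesis by simp
qed

lemma C1_on_space_has_derivative:
  assumes "C1_on_space f"
  shows "(f has_derivative (\<lambda>v. (\<chi> i. partial_deriv i f x) \<bullet> v)) (at x)"
proof -
  have d: "(f has_derivative frechet_derivative f (at x)) (at x)"
    using assms by (simp add: C1_on_space_def frechet_derivative_works)
  then have lin: "linear (frechet_derivative f (at x))" by (rule has_derivative_linear)
  have "frechet_derivative f (at x) v = (\<chi> i. partial_deriv i f x) \<bullet> v" for v
  proof -
    have "v = (\<Sum>i\<in>UNIV. v $ i *\<^sub>R axis i 1)"
      using basis_expansion[of v] by (simp add: scalar_mult_eq_scaleR)
    then have "frechet_derivative f (at x) v = frechet_derivative f (at x) (\<Sum>i\<in>UNIV. v $ i *\<^sub>R axis i 1)"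
      by (rule arg_cong)
    also have "\<dots> = (\<Sum>i\<in>UNIV. v $ i *\<^sub>R frechet_derivative f (at x) (axis i 1))"
      by (simp only: linear_sum[OF lin] linear_scale[OF lin])
    finally show ?thesis by (simp add: inner_vec_def partial_deriv_def mult.commute)
  qed
  then have "frechet_derivative f (at x) = (\<lambda>v. (\<chi> i. partial_deriv i f x) \<bullet> v)" by blast
  with d show ?thesis by metis
qed

lemma C2_on_space_grad_hess:
  assumes "C2_on_space u"
  shows "grad_hess u (\<lambda>x. \<chi> i. partial_deriv i u x) (hessian u)"
proof -
  define g where "g = (\<lambda>x. \<chi> i. partial_deriv i u x)"
  have C1: "C1_on_space u" "\<And>i. C1_on_space (partial_deriv i u)"
    using assms by (auto simp: C2_on_space_def)
  have u: "(u has_derivative (\<lambda>v. g x \<bullet> v)) (at x)" for x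
    unfolding g_def by (rule C1_on_space_has_derivative[OF C1(1)])
  have g: "(g has_derivative (\<lambda>v. transpose (hessian u x) *v v)) (at x)" for x
  proof -
    have "((\<lambda>x. g x \<bullet> axis i 1) has_derivative
        (\<lambda>v. (transpose (hessian u x) *v v) \<bullet> axis i 1)) (at x)" for i
    proof -
      have "(transpose (hessian u x) *v v) \<bullet> axis i 1 = (\<chi> j. partial_deriv j (partial_deriv i u) x) \<bullet> v"
        for v
        unfolding inner_axis
        by (simp add: matrix_vector_mult_def transpose_def hessian_def inner_vec_def
            del: transpose_matrix_vector)
      then show ?thesis
        using C1_on_space_has_derivative[OF C1(2), of i x] by (simp add: g_def inner_axis)
    qed
    then show ?thesis
      by (subst has_derivative_componentwise_within) (auto simp: Basis_vec_def)
  qed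
  have sym: "transpose (hessian u x) = hessian u x" for x
  proof -
    have "hessian u x $ i $ j = hessian u x $ j $ i" for i j
      using second_derivative_symmetric[OF u g, where x = x and a = "axis i 1" and b = "axis j 1"]
      by (simp add: matrix_vector_mult_basis inner_axis column_def transpose_def
          del: transpose_matrix_vector)
    then show ?thesis by (simp add: transpose_def vec_eq_iff)
  qed
  have "continuous_on UNIV (hessian u)"
    unfolding hessian_def using C1(2) by (intro continuous_intros) (simp add: C1_on_space_def)
  then show ?thesis
    using u g unfolding grad_hess_def sym by (simp add: g_def)
qed

section \<open>Viscosity inequality for the phase\<close>

text \<open>The analytic core, with the gradient and Hessian given as fields and convexity already replaced by
  positive definiteness of the Hessian.\<close>

locale self_shrinking_potential =
  fixes u :: "real ^ 'n \<Rightarrow> real" and g :: "real ^ 'n \<Rightarrow> real ^ 'n" and H :: "real ^ 'n \<Rightarrow> real ^ 'n ^ 'n"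
  assumes C2: "grad_hess u g H"
    and pos: "pos_def (H x)"
    and det_eq: "det (H x) = exp (real CARD('n) * (- u x + 1 / 2 * (x \<bullet> g x)))"
begin

definition phase :: "real ^ 'n \<Rightarrow> real" where
  "phase x = real CARD('n) * (- u x + 1 / 2 * (x \<bullet> g x))"

text \<open>The gradient of the phase. It involves only second derivatives of \<open>u\<close>, so the phase is \<open>C\<^sup>1\<close>.\<close>

definition phase_grad :: "real ^ 'n \<Rightarrow> real ^ 'n" where
  "phase_grad x = (real CARD('n) / 2) *\<^sub>R (H x *v x - g x)"

lemma det_phase: "det (H x) = exp (phase x)"
  by (simp add: det_eq phase_def)

lemma det_nonzero: "det (H x) \<noteq> 0"
  by (simp add: det_phase)

lemma phase_has_derivative: "(phase has_derivative (\<lambda>v. phase_grad x \<bullet> v)) (at x)"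
proof -
  have "((\<lambda>x. real CARD('n) * (- u x + 1 / 2 * (x \<bullet> g x))) has_derivative
      (\<lambda>v. real CARD('n) * (- (g x \<bullet> v) + 1 / 2 * (x \<bullet> (H x *v v) + v \<bullet> g x)))) (at x)"
    by (intro has_derivative_mult_right has_derivative_add has_derivative_minus
        has_derivative_inner has_derivative_ident grad_hess_gradient[OF C2] grad_hess_hessian[OF C2])
  moreover have "real CARD('n) * (- (g x \<bullet> v) + 1 / 2 * (x \<bullet> (H x *v v) + v \<bullet> g x))
      = phase_grad x \<bullet> v" for v
    using symmetric_form[OF pos_def_symmetric[OF pos], of x x v]
    by (simp add: phase_grad_def inner_diff_left inner_commute algebra_simps)
  ultimately show ?thesis by (simp add: phase_def[abs_def])
qed

lemma phase_tendsto:
  assumes "(X \<longlongrightarrow> x) F"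
  shows "((\<lambda>k. phase (X k)) \<longlongrightarrow> phase x) F"
  using has_derivative_continuous[OF phase_has_derivative] assms
  by (rule isCont_tendsto_compose)

lemma phase_continuous_on: "continuous_on S phase"
  using has_derivative_continuous[OF phase_has_derivative] continuous_at_imp_continuous_on by blast

lemma phase_grad_tendsto:
  assumes "(X \<longlongrightarrow> x) F"
  shows "((\<lambda>k. phase_grad (X k)) \<longlongrightarrow> phase_grad x) F"
  unfolding phase_grad_def
  by (intro tendsto_intros tendsto_matrix_vector grad_hess_tendsto[OF C2] assms)

text \<open>The derivative of \<open>u (s y) / s\<^sup>2\<close> in \<open>s\<close> is \<open>(2 / n) \<phi> (s y) / s\<^sup>3\<close>, so difference quotients of
  dilations are values of the phase at nearby points.\<close>

lemma dilation_difference_quotient: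
  assumes h: "0 < h"
  obtains s where "1 < s" "s < 1 + h"
    "real CARD('n) / (2 * h) * (u ((1 + h) *\<^sub>R y) / (1 + h)\<^sup>2 - u y) = phase (s *\<^sub>R y) / s ^ 3"
proof -
  have "((\<lambda>s. u (s *\<^sub>R y) / s\<^sup>2) has_real_derivative 2 / real CARD('n) * (phase (s *\<^sub>R y) / s ^ 3)) (at s)"
    if "1 \<le> s" "s \<le> 1 + h" for s
  proof -
    have u: "((\<lambda>s. u (s *\<^sub>R y)) has_real_derivative g (s *\<^sub>R y) \<bullet> y) (at s)"
      using line_derivative[OF grad_hess_gradient[OF C2], of 0 y s] by simp
    have "((\<lambda>s. u (s *\<^sub>R y) / s\<^sup>2) has_real_derivative
        ((g (s *\<^sub>R y) \<bullet> y) * s\<^sup>2 - u (s *\<^sub>R y) * (2 * s)) / (s\<^sup>2 * s\<^sup>2)) (at s)"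
      using that by (intro DERIV_divide u) (auto intro!: derivative_eq_intros)
    moreover have "((g (s *\<^sub>R y) \<bullet> y) * s\<^sup>2 - u (s *\<^sub>R y) * (2 * s)) / (s\<^sup>2 * s\<^sup>2)
        = 2 / real CARD('n) * (phase (s *\<^sub>R y) / s ^ 3)"
      using that by (simp add: phase_def field_simps inner_commute eval_nat_numeral)
    ultimately show ?thesis by simp
  qed
  from MVT2[OF _ this, of 1 "1 + h"] h obtain s where "1 < s" "s < 1 + h"
    "u ((1 + h) *\<^sub>R y) / (1 + h)\<^sup>2 - u y = h * (2 / real CARD('n) * (phase (s *\<^sub>R y) / s ^ 3))"
    by auto
  then show ?thesis
    using h by (intro that[of s]) (simp_all add: field_simps)
qed

lemma phase_radial_difference:
  assumes h: "0 < h"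
  obtains s where "1 < s" "s < 1 + h"
    "phase ((1 + h) *\<^sub>R y) - phase y = h * (phase_grad (s *\<^sub>R y) \<bullet> y)"
proof -
  have "((\<lambda>s. phase (s *\<^sub>R y)) has_real_derivative phase_grad (s *\<^sub>R y) \<bullet> y) (at s)" for s
    using line_derivative[OF phase_has_derivative, of 0 y s] by simp
  from MVT2[OF _ this, of 1 "1 + h"] h obtain s where "1 < s" "s < 1 + h"
    "phase ((1 + h) *\<^sub>R y) - phase y = h * (phase_grad (s *\<^sub>R y) \<bullet> y)"
    by auto
  then show ?thesis by (rule that)
qed

lemma log_det_comparison:
  "real CARD('n) - trace (matrix_inv (H y) ** H x) \<le> phase y - phase x"
proof -
  have "exp (phase x) \<le> exp (phase y) * exp (trace (matrix_inv (H y) ** H x) - real CARD('n))"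
    using det_le_exp_trace[OF pos pos, of x y] by (simp add: det_phase)
  then have "phase x \<le> phase y + (trace (matrix_inv (H y) ** H x) - real CARD('n))"
    by (simp flip: exp_add)
  then show ?thesis by simp
qed

text \<open>At a minimum of the difference quotient minus \<open>\<psi>\<close>, the matrix
  \<open>a (H ((1 + h) x) - H x) - P x\<close> with \<open>a = n / (2 h)\<close> is positive semidefinite. Tracing it against the inverse of
  \<open>H ((1 + h) x)\<close> and using concavity of \<open>ln det\<close> bounds the trace of \<open>P\<close> by a difference of phases.\<close>

lemma trace_inv_at_dilated_min:
  fixes \<psi> :: "real ^ 'n \<Rightarrow> real"
  assumes \<psi>: "grad_hess \<psi> q P" and h: "0 < h" and r: "0 < r"
    and min: "\<And>y. y \<in> ball x r \<Longrightarrow>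
      real CARD('n) / (2 * h) * (u ((1 + h) *\<^sub>R x) / (1 + h)\<^sup>2 - u x) - \<psi> x \<le>
      real CARD('n) / (2 * h) * (u ((1 + h) *\<^sub>R y) / (1 + h)\<^sup>2 - u y) - \<psi> y"
  shows "trace (matrix_inv (H ((1 + h) *\<^sub>R x)) ** P x) \<le>
    real CARD('n) / (2 * h) * (phase ((1 + h) *\<^sub>R x) - phase x)"
proof -
  define a where "a = real CARD('n) / (2 * h)"
  define B where "B = H ((1 + h) *\<^sub>R x)"
  have a: "a > 0" using h by (simp add: a_def)
  define N where "N = a *\<^sub>R B + ((- a) *\<^sub>R H x + (- 1) *\<^sub>R P x)"
  have "grad_hess
    (\<lambda>y. a * (u ((1 + h) *\<^sub>R y) / (1 + h)\<^sup>2) + ((- a) * u y + (- 1) * \<psi> y))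
    (\<lambda>y. a *\<^sub>R ((1 / (1 + h)) *\<^sub>R g ((1 + h) *\<^sub>R y)) + ((- a) *\<^sub>R g y + (- 1) *\<^sub>R q y))
    (\<lambda>y. a *\<^sub>R H ((1 + h) *\<^sub>R y) + ((- a) *\<^sub>R H y + (- 1) *\<^sub>R P y))"
    using h by (intro grad_hess_add grad_hess_cmult grad_hess_dilation C2 \<psi>) auto
  from hessian_psd_at_min[OF this r]
  have "0 \<le> v \<bullet> (N *v v)" for v
    using min unfolding N_def B_def a_def by (simp add: algebra_simps)
  then have "0 \<le> trace (matrix_inv B ** N)"
    unfolding B_def by (intro trace_inv_mult_psd_nonneg pos)
  also have "trace (matrix_inv B ** N) =
      a * (real CARD('n) - trace (matrix_inv B ** H x)) - trace (matrix_inv B ** P x)"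
  proof -
    have "matrix_inv B ** N = a *\<^sub>R (matrix_inv B ** B) + ((- a) *\<^sub>R (matrix_inv B ** H x)
        + (- 1) *\<^sub>R (matrix_inv B ** P x))"
      unfolding N_def by (simp only: matrix_add_ldistrib matrix_scalar_ac scalar_matrix_assoc)
    also have "matrix_inv B ** B = mat 1"
      unfolding B_def by (intro matrix_inv_inverse det_nonzero)
    finally have "trace (matrix_inv B ** N) = a * trace (mat 1 :: real ^ 'n ^ 'n)
        - a * trace (matrix_inv B ** H x) - trace (matrix_inv B ** P x)"
      by (simp add: trace_def sum.distrib sum_subtractf sum_negf sum_distrib_left)
    then show ?thesis by (simp add: trace_I algebra_simps)
  qed
  also have "a * (real CARD('n) - trace (matrix_inv B ** H x)) \<le> a * (phase ((1 + h) *\<^sub>R x) - phase x)"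
    unfolding B_def using a by (intro mult_left_mono log_det_comparison) simp
  finally show ?thesis by (simp add: B_def a_def)
qed

text \<open>Minimisers over a closed ball of the difference quotients minus \<open>\<psi>\<close> converge along a subsequence
  to a minimiser of \<open>\<phi> - \<psi>\<close>, which by strictness is \<open>z\<close>. So they are eventually interior, the
  preceding lemma applies to them, and its inequality passes to the limit because \<open>\<phi>\<close> is \<open>C\<^sup>1\<close> and
  \<open>H\<close> is continuous.\<close>

lemma viscosity_inequality_strict:
  fixes \<psi> :: "real ^ 'n \<Rightarrow> real"
  assumes \<psi>: "grad_hess \<psi> q P" and r: "0 < r"
    and strict: "\<And>y. y \<in> cball z r \<Longrightarrow> y \<noteq> z \<Longrightarrow> phase z - \<psi> z < phase y - \<psi> y"
  shows "trace (matrix_inv (H z) ** P z) \<le> real CARD('n) / 2 * (z \<bullet> q z)"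
proof -
  define h where "h k = 1 / real (Suc k)" for k
  have h: "h k > 0" for k by (simp add: h_def)
  have h0: "h \<longlonglongrightarrow> 0" unfolding h_def by (rule LIMSEQ_Suc[OF lim_1_over_n])
  define E where "E k y = real CARD('n) / (2 * h k) * (u ((1 + h k) *\<^sub>R y) / (1 + h k)\<^sup>2 - u y)" for k y
  have E: "\<exists>s. 1 < s \<and> s < 1 + h k \<and> E k y = phase (s *\<^sub>R y) / s ^ 3" for k y
    unfolding E_def using dilation_difference_quotient[OF h] by blast
  have "\<exists>x\<in>cball z r. \<forall>y\<in>cball z r. E k x - \<psi> x \<le> E k y - \<psi> y" for k
  proof (rule continuous_attains_inf)
    show "cball z r \<noteq> {}" using r by simp
    have "isCont u x" "isCont \<psi> x" for x
      using grad_hess_gradient[OF C2] grad_hess_gradient[OF \<psi>] has_derivative_continuous by blast+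
    then have "continuous_on UNIV u" "continuous_on (cball z r) \<psi>"
      by (simp_all add: continuous_at_imp_continuous_on)
    then show "continuous_on (cball z r) (\<lambda>x. E k x - \<psi> x)"
      unfolding E_def using h[of k]
      by (intro continuous_intros continuous_on_compose2[OF \<open>continuous_on UNIV u\<close>])
        (auto simp: add_nonneg_pos)
  qed simp
  then have "\<forall>k. \<exists>x. x \<in> cball z r \<and> (\<forall>y\<in>cball z r. E k x - \<psi> x \<le> E k y - \<psi> y)" by blast
  from choice[OF this] obtain x where x: "\<And>k. x k \<in> cball z r"
    and xmin: "\<And>k y. y \<in> cball z r \<Longrightarrow> E k (x k) - \<psi> (x k) \<le> E k y - \<psi> y" by blast
  obtain y \<rho> where y: "y \<in> cball z r" and \<rho>: "strict_mono \<rho>" "(x \<circ> \<rho>) \<longlonglongrightarrow> y"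
    using compact_cball x unfolding compact_def by meson
  define X where "X k = x (\<rho> k)" for k
  define t where "t k = h (\<rho> k)" for k
  have X: "X \<longlonglongrightarrow> y" using \<rho>(2) by (simp add: X_def[abs_def] comp_def)
  have t: "t \<longlonglongrightarrow> 0" "\<And>k. t k > 0"
    using LIMSEQ_subseq_LIMSEQ[OF h0 \<rho>(1)] h by (simp_all add: t_def[abs_def] comp_def)
  \<comment> \<open>Intermediate points from the mean value theorem tend to \<open>1\<close>.\<close>
  have squeeze: "s \<longlonglongrightarrow> 1" if "\<And>k. 1 < s k" "\<And>k. s k < 1 + t k" for s
  proof (rule tendsto_sandwich[of "\<lambda>_. 1" _ _ "\<lambda>k. 1 + t k"])
    show "(\<lambda>k. 1 + t k) \<longlonglongrightarrow> 1" using tendsto_add[OF tendsto_const[of 1] t(1)] by simp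
  qed (use that in \<open>auto intro!: always_eventually less_imp_le\<close>)
  have E_lim: "(\<lambda>k. E (\<rho> k) (Y k)) \<longlonglongrightarrow> phase w" if "Y \<longlonglongrightarrow> w" for Y w
  proof -
    have "\<forall>k. \<exists>s. 1 < s \<and> s < 1 + t k \<and> E (\<rho> k) (Y k) = phase (s *\<^sub>R Y k) / s ^ 3"
      unfolding t_def using E by blast
    from choice[OF this] obtain s where s: "\<And>k. 1 < s k" "\<And>k. s k < 1 + t k"
      "\<And>k. E (\<rho> k) (Y k) = phase (s k *\<^sub>R Y k) / s k ^ 3" by blast
    have "(\<lambda>k. phase (s k *\<^sub>R Y k) / s k ^ 3) \<longlonglongrightarrow> phase (1 *\<^sub>R w) / 1 ^ 3"
      by (intro tendsto_divide tendsto_power phase_tendsto tendsto_scaleR squeeze s that) auto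
    then show ?thesis by (simp add: s(3))
  qed
  have "phase y - \<psi> y \<le> phase z - \<psi> z"
  proof (rule LIMSEQ_le)
    show "(\<lambda>k. E (\<rho> k) (X k) - \<psi> (X k)) \<longlonglongrightarrow> phase y - \<psi> y"
      by (intro tendsto_diff E_lim X grad_hess_tendsto[OF \<psi>])
    show "(\<lambda>k. E (\<rho> k) z - \<psi> z) \<longlonglongrightarrow> phase z - \<psi> z"
      by (intro tendsto_diff E_lim tendsto_const)
    show "\<exists>N. \<forall>k\<ge>N. E (\<rho> k) (X k) - \<psi> (X k) \<le> E (\<rho> k) z - \<psi> z"
      using xmin r by (simp add: X_def)
  qed
  then have "y = z" using strict[OF y] by fastforce
  with X have Xz: "X \<longlonglongrightarrow> z" by simp
  have "\<forall>k. \<exists>s. 1 < s \<and> s < 1 + t k \<and>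
      phase ((1 + t k) *\<^sub>R X k) - phase (X k) = t k * (phase_grad (s *\<^sub>R X k) \<bullet> X k)"
    using phase_radial_difference[OF t(2)] by blast
  from choice[OF this] obtain s where s: "\<And>k. 1 < s k" "\<And>k. s k < 1 + t k"
    "\<And>k. phase ((1 + t k) *\<^sub>R X k) - phase (X k) = t k * (phase_grad (s k *\<^sub>R X k) \<bullet> X k)" by blast
  have "eventually (\<lambda>k. X k \<in> ball z r) sequentially"
    using Xz r by (intro topological_tendstoD) auto
  then have ev: "eventually (\<lambda>k. trace (matrix_inv (H ((1 + t k) *\<^sub>R X k)) ** P (X k)) \<le>
      real CARD('n) / 2 * (phase_grad (s k *\<^sub>R X k) \<bullet> X k)) sequentially"
  proof (rule eventually_mono)
    fix k assume k: "X k \<in> ball z r"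
    have "trace (matrix_inv (H ((1 + t k) *\<^sub>R X k)) ** P (X k)) \<le>
      real CARD('n) / (2 * t k) * (phase ((1 + t k) *\<^sub>R X k) - phase (X k))"
    proof (rule trace_inv_at_dilated_min[OF \<psi> t(2)])
      show "0 < r - dist z (X k)" using k by simp
      fix y assume "y \<in> ball (X k) (r - dist z (X k))"
      then have "y \<in> cball z r" using dist_triangle[of z y "X k"] by simp
      then have "E (\<rho> k) (X k) - \<psi> (X k) \<le> E (\<rho> k) y - \<psi> y" unfolding X_def by (rule xmin)
      then show "real CARD('n) / (2 * t k) * (u ((1 + t k) *\<^sub>R X k) / (1 + t k)\<^sup>2 - u (X k)) - \<psi> (X k) \<le>
        real CARD('n) / (2 * t k) * (u ((1 + t k) *\<^sub>R y) / (1 + t k)\<^sup>2 - u y) - \<psi> y"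
        by (simp add: E_def t_def)
    qed
    also have "\<dots> = real CARD('n) / 2 * (phase_grad (s k *\<^sub>R X k) \<bullet> X k)"
      using t(2)[of k] by (simp add: s(3))
    finally show "trace (matrix_inv (H ((1 + t k) *\<^sub>R X k)) ** P (X k)) \<le>
      real CARD('n) / 2 * (phase_grad (s k *\<^sub>R X k) \<bullet> X k)" .
  qed
  have t1: "(\<lambda>k. 1 + t k) \<longlonglongrightarrow> 1" using tendsto_add[OF tendsto_const[of 1] t(1)] by simp
  have "(\<lambda>k. (1 + t k) *\<^sub>R X k) \<longlonglongrightarrow> z" using tendsto_scaleR[OF t1 Xz] by simp
  then have lhs: "(\<lambda>k. trace (matrix_inv (H ((1 + t k) *\<^sub>R X k)) ** P (X k)))
      \<longlonglongrightarrow> trace (matrix_inv (H z) ** P z)"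
    by (intro tendsto_trace_mult tendsto_matrix_inv grad_hess_tendsto[OF C2] grad_hess_tendsto[OF \<psi>]
        det_nonzero Xz)
  have "(\<lambda>k. s k *\<^sub>R X k) \<longlonglongrightarrow> z" using tendsto_scaleR[OF squeeze[OF s(1,2)] Xz] by simp
  then have rhs: "(\<lambda>k. real CARD('n) / 2 * (phase_grad (s k *\<^sub>R X k) \<bullet> X k))
      \<longlonglongrightarrow> real CARD('n) / 2 * (phase_grad z \<bullet> z)"
    by (intro tendsto_mult tendsto_const tendsto_inner phase_grad_tendsto Xz)
  have "trace (matrix_inv (H z) ** P z) \<le> real CARD('n) / 2 * (phase_grad z \<bullet> z)"
    by (rule tendsto_le[OF sequentially_bot rhs lhs ev])
  moreover have "phase_grad z - q z = 0"
  proof (rule gradient_zero_at_min)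
    show "((\<lambda>x. phase x - \<psi> x) has_derivative (\<lambda>v. (phase_grad z - q z) \<bullet> v)) (at z)"
      unfolding inner_diff_left
      by (intro has_derivative_diff phase_has_derivative grad_hess_gradient[OF \<psi>])
    show "phase z - \<psi> z \<le> phase y - \<psi> y" if "y \<in> ball z r" for y
      using strict[of y] that by (cases "y = z") auto
  qed (rule r)
  ultimately show ?thesis by (simp add: inner_commute)
qed

text \<open>Lowering \<open>\<psi>\<close> by \<open>\<eta> |x - z|\<^sup>2\<close> makes the minimum strict and changes the trace by a multiple of
  \<open>\<eta>\<close>, which is arbitrary.\<close>

lemma viscosity_inequality:
  fixes \<psi> :: "real ^ 'n \<Rightarrow> real"
  assumes \<psi>: "grad_hess \<psi> q P" and r: "0 < r"
    and min: "\<And>y. y \<in> ball z r \<Longrightarrow> phase z - \<psi> z \<le> phase y - \<psi> y"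
  shows "trace (matrix_inv (H z) ** P z) \<le> real CARD('n) / 2 * (z \<bullet> q z)"
proof (rule field_le_epsilon)
  fix e :: real assume e: "e > 0"
  define C where "C = matrix_inv (H z)"
  define \<eta> where "\<eta> = e / (2 * \<bar>trace C\<bar> + 1)"
  have \<eta>: "\<eta> > 0" using e by (simp add: \<eta>_def add_nonneg_pos)
  let ?d = "\<lambda>x. (x - z) \<bullet> (x - z)"
  have "grad_hess (\<lambda>x. - \<eta> * ?d x) (\<lambda>x. (2 * - \<eta>) *\<^sub>R (x - z))
      (\<lambda>x. (2 * - \<eta>) *\<^sub>R mat 1 + (4 * 0) *\<^sub>R outer (x - z))"
    by (rule grad_hess_radial) (auto intro!: derivative_eq_intros)
  from grad_hess_add[OF \<psi> this]
  have "trace (C ** (P z + ((2 * - \<eta>) *\<^sub>R mat 1 + (4 * 0) *\<^sub>R outer (z - z)))) \<le>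
    real CARD('n) / 2 * (z \<bullet> (q z + (2 * - \<eta>) *\<^sub>R (z - z)))"
    unfolding C_def
  proof (rule viscosity_inequality_strict)
    show "0 < r / 2" using r by simp
    fix y assume "y \<in> cball z (r / 2)" "y \<noteq> z"
    then have "phase z - \<psi> z \<le> phase y - \<psi> y" "0 < ?d y"
      using r min by simp_all
    then show "phase z - (\<psi> z + - \<eta> * ?d z) < phase y - (\<psi> y + - \<eta> * ?d y)"
      using mult_pos_pos[OF \<eta> \<open>0 < ?d y\<close>] by simp
  qed
  then have "trace (C ** P z) - 2 * \<eta> * trace C \<le> real CARD('n) / 2 * (z \<bullet> q z)"
    unfolding matrix_add_ldistrib[of C "P z"] trace_add trace_mult_rank_one_update by simp
  moreover have "2 * \<eta> * trace C \<le> e"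
  proof -
    have "2 * \<eta> * trace C \<le> \<eta> * (2 * \<bar>trace C\<bar> + 1)"
      using \<eta> by (simp add: distrib_left add_increasing2)
    also have "\<dots> = e" by (simp add: \<eta>_def add_nonneg_pos)
    finally show ?thesis .
  qed
  ultimately show "trace (matrix_inv (H z) ** P z) \<le> real CARD('n) / 2 * (z \<bullet> q z) + e"
    by (simp add: C_def)
qed


section \<open>Existence of a minimum\<close>

text \<open>The determinant is at least the \<open>n\<close>-th power of the lower eigenvalue bound; this is the tangent
  inequality for \<open>ln det\<close> between \<open>m I\<close> and the Hessian.\<close>

lemma phase_lower_bound:
  assumes m: "m > 0" and low: "\<And>w. m * (w \<bullet> w) \<le> w \<bullet> (H x *v w)"
  shows "real CARD('n) * ln m \<le> phase x"
proof -
  define C where "C = matrix_inv (H x)"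
  have up: "w \<bullet> (C *v w) \<le> 1 / m * (w \<bullet> w)" for w
    unfolding C_def using matrix_inv_form_upper[OF pos m low] by simp
  define e where "e = (axis undefined 1 :: real ^ 'n)"
  have e: "norm e = 1" by (simp add: e_def)
  have "trace C \<le> e \<bullet> (C *v e) + (real CARD('n) - 1) * (1 / m)"
    by (rule trace_le_direction[OF up e])
  also have "e \<bullet> (C *v e) \<le> 1 / m" using up[of e] e by (simp add: dot_square_norm)
  finally have tr: "m * trace C \<le> real CARD('n)" using m by (simp add: field_simps)
  have "m * (v \<bullet> v) > 0" if "v \<noteq> 0" for v :: "real ^ 'n" using that m by simp
  moreover have "(m *\<^sub>R mat 1) *v v = m *\<^sub>R v" for v :: "real ^ 'n"
    by (simp flip: scaleR_matrix_vector_assoc)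
  ultimately have "pos_def (m *\<^sub>R mat 1 :: real ^ 'n ^ 'n)"
    by (simp add: pos_def_def transpose_scalar)
  from det_le_exp_trace[OF this pos, of x]
  have "det (m *\<^sub>R mat 1 :: real ^ 'n ^ 'n) \<le>
      exp (phase x) * exp (trace (C ** (m *\<^sub>R mat 1)) - real CARD('n))"
    by (simp add: det_phase C_def)
  also have "trace (C ** (m *\<^sub>R mat 1)) = m * trace C"
    using trace_mult_rank_one_update[of C m 0 0] by simp
  also have "exp (phase x) * exp (m * trace C - real CARD('n)) \<le> exp (phase x) * 1"
    using tr by (intro mult_left_mono) simp_all
  also have "det (m *\<^sub>R mat 1 :: real ^ 'n ^ 'n) = m ^ CARD('n)"
    by (subst det_diagonal) (simp_all add: mat_def)
  finally have "ln (m ^ CARD('n)) \<le> ln (exp (phase x))"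
    using m by (subst ln_le_cancel_iff) simp_all
  then show ?thesis using m by (simp add: ln_realpow)
qed

text \<open>The viscosity inequality for the test function \<open>- \<epsilon> \<rho>\<close> with \<open>\<rho> = sqrt (1 + |x|\<^sup>2)\<close>, whose Hessian is
  \<open>- (\<epsilon> / \<rho>) (I - x x\<^sup>T / \<rho>\<^sup>2)\<close>. The rank one part removes the radial contribution to the
  trace of the inverse Hessian except for a fraction \<open>1 / \<rho>\<^sup>2\<close> of it, which is at most \<open>1 / c\<close>. The
  conclusion bounds \<open>|z|\<close> independently of \<open>\<epsilon>\<close> as soon as \<open>c > 2 (n - 1) / n\<close>.\<close>

lemma hyperbolic_barrier_touching:
  assumes c: "0 < c" and z: "z \<noteq> 0"
    and low: "\<And>w. c * (w \<bullet> w) \<le> (norm z)\<^sup>2 * (w \<bullet> (H z *v w))"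
    and \<epsilon>: "0 < \<epsilon>"
    and min: "\<And>y. phase z + \<epsilon> * sqrt (1 + z \<bullet> z) \<le> phase y + \<epsilon> * sqrt (1 + y \<bullet> y)"
  shows "(real CARD('n) / 2 - (real CARD('n) - 1) / c) * (norm z)\<^sup>2 \<le> 1 / c"
proof -
  define C where "C = matrix_inv (H z)"
  define K where "K = (norm z)\<^sup>2 / c"
  define \<rho> where "\<rho> = sqrt (1 + z \<bullet> z)"
  have \<rho>: "\<rho> > 0" "\<rho>\<^sup>2 = 1 + (norm z)\<^sup>2"
    by (simp_all add: \<rho>_def add_pos_nonneg power2_norm_eq_inner)
  let ?F = "\<lambda>s. - \<epsilon> * sqrt (1 + s)" and ?F' = "\<lambda>s. - \<epsilon> / (2 * sqrt (1 + s))"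
    and ?F'' = "\<lambda>s. \<epsilon> / (4 * (1 + s) * sqrt (1 + s))"
  have "grad_hess (\<lambda>x. ?F ((x - 0) \<bullet> (x - 0))) (\<lambda>x. (2 * ?F' ((x - 0) \<bullet> (x - 0))) *\<^sub>R (x - 0))
    (\<lambda>x. (2 * ?F' ((x - 0) \<bullet> (x - 0))) *\<^sub>R mat 1 + (4 * ?F'' ((x - 0) \<bullet> (x - 0))) *\<^sub>R outer (x - 0))"
  proof (rule grad_hess_radial)
    fix s :: real assume s: "0 \<le> s"
    show "(?F has_real_derivative ?F' s) (at s)"
      using s by (auto intro!: derivative_eq_intros simp: field_simps)
    define q where "q = sqrt (1 + s)"
    have q: "q > 0" "1 + s = q * q" using s by (simp_all add: q_def)
    have "(?F' has_real_derivative - (- \<epsilon> * (2 * (inverse (sqrt (1 + s)) / 2))) / (2 * sqrt (1 + s))\<^sup>2) (at s)"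
      using s by (auto intro!: derivative_eq_intros simp: power2_eq_square field_simps)
    moreover have "- (- \<epsilon> * (2 * (inverse (sqrt (1 + s)) / 2))) / (2 * sqrt (1 + s))\<^sup>2 = ?F'' s"
      unfolding q_def[symmetric] q(2) using q(1) by (simp add: field_simps power2_eq_square)
    ultimately show "(?F' has_real_derivative ?F'' s) (at s)" by simp
  next
    show "continuous_on {0..} ?F''"
      by (intro continuous_intros) auto
  qed
  from viscosity_inequality[OF this zero_less_one, of z] min
  have "trace (C ** ((2 * ?F' (z \<bullet> z)) *\<^sub>R mat 1 + (4 * ?F'' (z \<bullet> z)) *\<^sub>R outer z))
      \<le> real CARD('n) / 2 * (z \<bullet> ((2 * ?F' (z \<bullet> z)) *\<^sub>R z))"
    using \<epsilon> by (simp add: C_def)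
  also have "2 * ?F' (z \<bullet> z) = - (\<epsilon> / \<rho>)" by (simp add: \<rho>_def)
  also have "4 * ?F'' (z \<bullet> z) = \<epsilon> / \<rho> / \<rho>\<^sup>2"
  proof -
    have aux: "1 + z \<bullet> z = \<rho>\<^sup>2" by (simp add: \<rho>(2) power2_norm_eq_inner)
    show ?thesis unfolding \<rho>_def[symmetric] unfolding aux by simp
  qed
  finally have "\<epsilon> / \<rho> * (real CARD('n) / 2 * (norm z)\<^sup>2) \<le>
      \<epsilon> / \<rho> * (trace C - (z \<bullet> (C *v z)) / \<rho>\<^sup>2)"
    unfolding trace_mult_rank_one_update by (simp add: power2_norm_eq_inner algebra_simps)
  then have 1: "real CARD('n) / 2 * (norm z)\<^sup>2 \<le> trace C - (z \<bullet> (C *v z)) / \<rho>\<^sup>2"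
    by (rule mult_left_le_imp_le) (use \<epsilon> \<rho>(1) in simp)
  have K: "K > 0" using z c by (simp add: K_def)
  have up: "w \<bullet> (C *v w) \<le> K * (w \<bullet> w)" for w
  proof -
    have "1 / K * (w \<bullet> w) \<le> w \<bullet> (H z *v w)" for w
      using low[of w] z c by (simp add: K_def field_simps)
    from matrix_inv_form_upper[OF pos _ this] K show ?thesis by (simp add: C_def mult.commute)
  qed
  define e where "e = (1 / norm z) *\<^sub>R z"
  have e: "norm e = 1" "z = norm z *\<^sub>R e" using z by (simp_all add: e_def)
  define A where "A = e \<bullet> (C *v e)"
  have zz: "z \<bullet> (C *v z) = (norm z)\<^sup>2 * A"
    by (subst (1 2) e(2)) (simp add: A_def matrix_vector_mult_scaleR power2_eq_square)
  have AK: "A \<le> K" using up[of e] e(1) by (simp add: A_def dot_square_norm)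
  have "trace C \<le> A + (real CARD('n) - 1) * K"
    unfolding A_def by (rule trace_le_direction[OF up e(1)])
  with 1 have "real CARD('n) / 2 * (norm z)\<^sup>2 \<le> (real CARD('n) - 1) * K + (A - (norm z)\<^sup>2 * A / \<rho>\<^sup>2)"
    by (simp add: zz)
  also have "A - (norm z)\<^sup>2 * A / \<rho>\<^sup>2 = A / \<rho>\<^sup>2"
  proof -
    have nz: "(norm z)\<^sup>2 = \<rho>\<^sup>2 - 1" by (simp add: \<rho>(2))
    show ?thesis unfolding nz using \<rho>(1) by (simp add: field_simps)
  qed
  also have "A / \<rho>\<^sup>2 \<le> K / \<rho>\<^sup>2" using AK by (simp add: divide_right_mono)
  also have "K / \<rho>\<^sup>2 \<le> 1 / c"
    unfolding K_def \<rho>(2) using c by (simp add: field_simps add_pos_nonneg)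
  finally show ?thesis by (simp add: K_def algebra_simps)
qed

text \<open>For each \<open>\<epsilon>\<close> the coercive function \<open>\<phi> + \<epsilon> \<rho>\<close> has a global minimiser, and by the barrier it lies in
  a ball of radius independent of \<open>\<epsilon>\<close>. Letting \<open>\<epsilon>\<close> tend to zero shows that the minimum of \<open>\<phi>\<close> over that
  ball is global.\<close>

lemma phase_attains_min:
  assumes c: "c > 2 * (real CARD('n) - 1) / real CARD('n)"
    and low: "\<And>x w. R0 \<le> norm x \<Longrightarrow> c * (w \<bullet> w) \<le> (norm x)\<^sup>2 * (w \<bullet> (H x *v w))"
  obtains z where "\<And>x. phase z \<le> phase x"
proof -
  define n where "n = real CARD('n)"
  have n: "n \<ge> 1" by (simp add: n_def Suc_leI)
  have "0 \<le> 2 * (n - 1) / n" using n by simp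
  with c have c0: "c > 0" unfolding n_def by linarith
  \<comment> \<open>The gap left by the growth condition; positive precisely if \<open>c > 2 (n - 1) / n\<close>.\<close>
  define \<kappa> where "\<kappa> = n / 2 - (n - 1) / c"
  have \<kappa>: "\<kappa> > 0" using c c0 n by (simp add: \<kappa>_def n_def[symmetric] field_simps)
  \<comment> \<open>Beyond \<open>R\<close> both the growth bound holds and \<open>\<kappa> |p|\<^sup>2 > 1 / c\<close>, since \<open>|p| \<ge> 1\<close>.\<close>
  define R where "R = max R0 (1 + 1 / (c * \<kappa>))"
  have R: "R \<ge> R0" "R \<ge> 1 + 1 / (c * \<kappa>)" "R \<ge> 1"
  proof -
    have "1 / (c * \<kappa>) \<ge> 0" using c0 \<kappa> by simp
    then show "R \<ge> R0" "R \<ge> 1 + 1 / (c * \<kappa>)" "R \<ge> 1" unfolding R_def by linarith+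
  qed
  have "compact (cball 0 R :: (real ^ 'n) set)" "(cball 0 R :: (real ^ 'n) set) \<noteq> {}" using R by auto
  from continuous_attains_inf[OF this phase_continuous_on]
  obtain z where "\<forall>x\<in>cball 0 R. phase z \<le> phase x" by blast
  then have z: "phase z \<le> phase x" if "norm x \<le> R" for x using that by simp
  have "phase z \<le> phase x + e" if e: "e > 0" for x e
  proof -
    \<comment> \<open>The perturbation then has the value \<open>e\<close> at \<open>x\<close>.\<close>
    define \<epsilon> where "\<epsilon> = e / sqrt (1 + x \<bullet> x)"
    have \<epsilon>: "\<epsilon> > 0" using e by (simp add: \<epsilon>_def add_pos_nonneg)
    define f where "f y = phase y + \<epsilon> * sqrt (1 + y \<bullet> y)" for y
    \<comment> \<open>With this slope, the linear bound on \<open>ln\<close> uses up half of the growth of \<open>\<epsilon> |y|\<close>.\<close>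
    define \<delta> where "\<delta> = \<epsilon> / (4 * n)"
    have \<delta>: "\<delta> > 0" using \<epsilon> n by (simp add: \<delta>_def)
    define D where "D = n * ln c + 2 * n * (ln \<delta> + 1)"
    have coercive: "D + \<epsilon> / 2 * norm y \<le> f y" if y: "norm y \<ge> R" for y
    proof -
      have ny: "norm y > 0" using y R by linarith
      have "c / (norm y)\<^sup>2 * (w \<bullet> w) \<le> w \<bullet> (H y *v w)" for w
        using low[of y w] y R ny by (simp add: field_simps)
      then have "n * ln (c / (norm y)\<^sup>2) \<le> phase y"
        unfolding n_def using ny c0 by (intro phase_lower_bound) auto
      moreover have "ln (c / (norm y)\<^sup>2) = ln c - 2 * ln (norm y)"
        using ny c0 by (simp add: ln_div ln_realpow)
      ultimately have 1: "n * ln c - n * (2 * ln (norm y)) \<le> phase y"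
        by (simp add: right_diff_distrib)
      have "ln (norm y) \<le> \<delta> * norm y - 1 - ln \<delta>"
        using ln_le_minus_one[of "\<delta> * norm y"] ny \<delta> by (simp add: ln_mult)
      then have "n * (2 * ln (norm y)) \<le> n * (2 * (\<delta> * norm y - 1 - ln \<delta>))"
        using n by (intro mult_left_mono) auto
      also have "\<dots> = (2 * n * \<delta>) * norm y - 2 * n * (ln \<delta> + 1)" by (simp add: algebra_simps)
      also have "2 * n * \<delta> = \<epsilon> / 2" using n by (simp add: \<delta>_def)
      finally have 2: "n * (2 * ln (norm y)) \<le> \<epsilon> / 2 * norm y - 2 * n * (ln \<delta> + 1)" .
      have "\<epsilon> * norm y \<le> \<epsilon> * sqrt (1 + y \<bullet> y)"
        using \<epsilon> by (intro mult_left_mono) (auto simp: norm_eq_sqrt_inner)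
      with 1 2 show ?thesis unfolding D_def f_def by linarith
    qed
    define S where "S = max R (2 * (f 0 - D) / \<epsilon>)"
    have far: "f 0 \<le> f y" if "norm y \<ge> S" for y
    proof -
      have "2 * (f 0 - D) / \<epsilon> \<le> norm y" using that by (simp add: S_def)
      then have "f 0 \<le> D + \<epsilon> / 2 * norm y" using \<epsilon> by (simp add: field_simps)
      also have "\<dots> \<le> f y" using that by (intro coercive) (simp add: S_def)
      finally show ?thesis .
    qed
    have "0 \<le> S" using R by (simp add: S_def)
    then have "compact (cball 0 S :: (real ^ 'n) set)" "0 \<in> (cball 0 S :: (real ^ 'n) set)" by auto
    moreover have "continuous_on (cball 0 S) f"
      unfolding f_def by (intro continuous_intros phase_continuous_on)
    ultimately have "\<exists>p\<in>cball 0 S. \<forall>y\<in>cball 0 S. f p \<le> f y"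
      by (intro continuous_attains_inf) blast+
    then obtain p where "\<forall>y\<in>cball 0 S. f p \<le> f y" by blast
    then have p: "f p \<le> f y" if "norm y \<le> S" for y using that by simp
    have pmin: "f p \<le> f y" for y
      using p[of y] p[of 0] far[of y] \<open>0 \<le> S\<close> by (cases "norm y \<le> S") auto
    have "norm p \<le> R"
    proof (rule ccontr)
      assume pR: "\<not> norm p \<le> R"
      then have "p \<noteq> 0" using R by auto
      then have "\<kappa> * (norm p)\<^sup>2 \<le> 1 / c"
        unfolding \<kappa>_def n_def
        by (rule hyperbolic_barrier_touching[OF c0 _ low \<epsilon>]) (use pR R pmin in \<open>auto simp: f_def\<close>)
      then have "(norm p)\<^sup>2 \<le> 1 / (c * \<kappa>)" using \<kappa> c0 by (simp add: field_simps)
      moreover have "norm p * 1 \<le> norm p * norm p"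
        using pR R by (intro mult_left_mono) auto
      ultimately show False using pR R by (simp add: power2_eq_square)
    qed
    then have "phase z \<le> phase p" by (rule z)
    also have "\<dots> \<le> f p" using \<epsilon> by (simp add: f_def)
    also have "\<dots> \<le> f x" by (rule pmin)
    also have "\<dots> = phase x + e"
    proof -
      have "sqrt (1 + x \<bullet> x) > 0" by (simp add: add_pos_nonneg)
      then show ?thesis by (simp add: f_def \<epsilon>_def)
    qed
    finally show ?thesis .
  qed
  then have "phase z \<le> phase x" for x by (rule field_le_epsilon)
  then show ?thesis by (rule that)
qed

section \<open>Strong minimum principle\<close>

lemma trace_inv_tendsto:
  assumes "(X \<longlongrightarrow> x) F"
  shows "((\<lambda>k. trace (matrix_inv (H (X k)))) \<longlongrightarrow> trace (matrix_inv (H x))) F"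
  unfolding trace_def
  by (intro tendsto_sum tendsto_vec_nth tendsto_matrix_inv grad_hess_tendsto[OF C2] det_nonzero assms)

text \<open>The inequality says that \<open>exp (- \<alpha> |x - p|\<^sup>2)\<close> is a strict subsolution on \<open>K\<close>. Away from \<open>p\<close> the
  quadratic form on the right is positive, so by compactness a large \<open>\<alpha>\<close> works.\<close>

lemma exponential_barrier_constant:
  assumes K: "compact K" and p: "p \<notin> K"
  shows "\<exists>\<alpha>>0. \<forall>x\<in>K. 2 * trace (matrix_inv (H x)) - real CARD('n) * (x \<bullet> (x - p))
      < 4 * \<alpha> * ((x - p) \<bullet> (matrix_inv (H x) *v (x - p)))"
proof -
  define Q where "Q x = (x - p) \<bullet> (matrix_inv (H x) *v (x - p))" for x
  define T where "T x = 2 * trace (matrix_inv (H x)) - real CARD('n) * (x \<bullet> (x - p))" for x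
  have Q: "Q x > 0" if "x \<in> K" for x
  proof -
    have "x - p \<noteq> 0" using that p by auto
    then show ?thesis using pos_def_matrix_inv[OF pos, of x] by (simp add: Q_def pos_def_def)
  qed
  have "continuous_on K (\<lambda>x. T x / (4 * Q x))"
    unfolding continuous_on_def
  proof
    fix x assume x: "x \<in> K"
    have "(T \<longlongrightarrow> T x) (at x within K)"
      unfolding T_def by (intro tendsto_intros trace_inv_tendsto)
    moreover have "(Q \<longlongrightarrow> Q x) (at x within K)"
      unfolding Q_def by (intro tendsto_intros tendsto_matrix_vector tendsto_matrix_inv
          grad_hess_tendsto[OF C2] det_nonzero)
    ultimately show "((\<lambda>x. T x / (4 * Q x)) \<longlongrightarrow> T x / (4 * Q x)) (at x within K)"
      using Q[OF x] by (intro tendsto_intros) auto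
  qed
  then have "bounded ((\<lambda>x. T x / (4 * Q x)) ` K)"
    using K by (intro compact_imp_bounded compact_continuous_image)
  then obtain M where M: "\<And>x. x \<in> K \<Longrightarrow> \<bar>T x / (4 * Q x)\<bar> \<le> M"
    by (auto simp: bounded_iff)
  show ?thesis
  proof (intro exI[of _ "max M 0 + 1"] conjI ballI)
    show "max M 0 + 1 > 0" by simp
    fix x assume x: "x \<in> K"
    have "T x / (4 * Q x) < max M 0 + 1" using M[OF x] by linarith
    then have "T x < 4 * (max M 0 + 1) * Q x" using Q[OF x] by (simp add: field_simps)
    then show "2 * trace (matrix_inv (H x)) - real CARD('n) * (x \<bullet> (x - p))
      < 4 * (max M 0 + 1) * ((x - p) \<bullet> (matrix_inv (H x) *v (x - p)))"
      by (simp add: T_def Q_def)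
  qed
qed

text \<open>The viscosity inequality at \<open>z\<close> would reverse the strict subsolution inequality there.\<close>

lemma exponential_barrier_not_touching:
  assumes \<alpha>: "\<alpha> > 0" and \<epsilon>: "\<epsilon> > 0" and r: "r > 0"
    and sub: "2 * trace (matrix_inv (H z)) - real CARD('n) * (z \<bullet> (z - p))
      < 4 * \<alpha> * ((z - p) \<bullet> (matrix_inv (H z) *v (z - p)))"
    and min: "\<And>y. y \<in> ball z r \<Longrightarrow>
      phase z - \<epsilon> * exp (- \<alpha> * ((z - p) \<bullet> (z - p))) \<le> phase y - \<epsilon> * exp (- \<alpha> * ((y - p) \<bullet> (y - p)))"
  shows False
proof -
  define C where "C = matrix_inv (H z)"
  let ?F = "\<lambda>s. \<epsilon> * exp (- \<alpha> * s)" and ?F' = "\<lambda>s. - \<alpha> * \<epsilon> * exp (- \<alpha> * s)"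
    and ?F'' = "\<lambda>s. \<alpha>\<^sup>2 * \<epsilon> * exp (- \<alpha> * s)"
  define d where "d = (z - p) \<bullet> (z - p)"
  have "grad_hess (\<lambda>x. ?F ((x - p) \<bullet> (x - p))) (\<lambda>x. (2 * ?F' ((x - p) \<bullet> (x - p))) *\<^sub>R (x - p))
    (\<lambda>x. (2 * ?F' ((x - p) \<bullet> (x - p))) *\<^sub>R mat 1 + (4 * ?F'' ((x - p) \<bullet> (x - p))) *\<^sub>R outer (x - p))"
    by (rule grad_hess_radial)
      (auto intro!: derivative_eq_intros continuous_intros simp: power2_eq_square)
  from viscosity_inequality[OF this r min]
  have "trace (C ** ((2 * ?F' d) *\<^sub>R mat 1 + (4 * ?F'' d) *\<^sub>R outer (z - p)))
      \<le> real CARD('n) / 2 * (z \<bullet> ((2 * ?F' d) *\<^sub>R (z - p)))"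
    by (simp add: C_def d_def)
  then have "(\<alpha> * \<epsilon> * exp (- \<alpha> * d)) * (4 * \<alpha> * ((z - p) \<bullet> (C *v (z - p)))) \<le>
      (\<alpha> * \<epsilon> * exp (- \<alpha> * d)) * (2 * trace C - real CARD('n) * (z \<bullet> (z - p)))"
    unfolding trace_mult_rank_one_update by (simp add: algebra_simps power2_eq_square)
  then have "4 * \<alpha> * ((z - p) \<bullet> (C *v (z - p))) \<le> 2 * trace C - real CARD('n) * (z \<bullet> (z - p))"
    using \<alpha> \<epsilon> by (simp add: mult_le_cancel_left)
  with sub show False by (simp add: C_def)
qed

text \<open>Hopf's argument. If the minimum set is not everything, some ball inside its complement touches it;
  halving the ball towards the contact point \<open>y\<close> makes \<open>y\<close> the only contact. Subtract a small multiple of the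
  exponential barrier centred at the midpoint. On a small sphere around \<open>y\<close> the perturbed phase exceeds its value
  at \<open>y\<close>: inside the halved ball because the phase is bounded away from its minimum, outside
  because the barrier is smaller than at \<open>y\<close>. So there is an interior minimum, which the barrier excludes.\<close>

lemma strong_minimum_principle:
  assumes min: "\<And>x. phase z \<le> phase x"
  shows "phase x = phase z"
proof (rule ccontr)
  assume ne: "phase x \<noteq> phase z"
  define m where "m = phase z"
  define Z where "Z = {w. phase w = m}"
  have "closed Z"
    unfolding Z_def by (intro closed_Collect_eq phase_continuous_on continuous_on_const)
  moreover have "Z \<noteq> {}" by (auto simp: Z_def m_def)
  ultimately obtain y where y: "y \<in> Z" "\<And>w. w \<in> Z \<Longrightarrow> dist x y \<le> dist x w"
    using distance_attains_inf by blast
  have "x \<noteq> y" using ne y(1) by (auto simp: Z_def m_def)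
  define p where "p = x + (1 / 2) *\<^sub>R (y - x)"
  define R where "R = dist x y / 2"
  have R: "R > 0" using \<open>x \<noteq> y\<close> by (simp add: R_def)
  have half: "p - x = (1 / 2) *\<^sub>R (y - x)" "y - p = (1 / 2) *\<^sub>R (y - x)"
    by (simp_all add: p_def vec_eq_iff field_simps)
  then have px: "norm (p - x) = R" and yp: "norm (y - p) = R"
    by (simp_all add: R_def dist_norm norm_minus_commute)
  have parallelogram: "(norm (a - b))\<^sup>2 = 2 * (norm a)\<^sup>2 + 2 * (norm b)\<^sup>2 - (norm (a + b))\<^sup>2"
    for a b :: "real ^ 'n"
    by (simp add: power2_norm_eq_inner inner_add_left inner_add_right inner_diff_left
        inner_diff_right inner_commute)
  have touch: "m < phase w" if w: "norm (w - p) \<le> R" "w \<noteq> y" for w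
  proof (rule ccontr)
    assume "\<not> m < phase w"
    then have "w \<in> Z" using min[of w] by (simp add: Z_def m_def)
    then have "2 * R \<le> norm ((p - x) + (w - p))"
      using y(2) by (simp add: R_def dist_norm norm_minus_commute)
    then have "(2 * R)\<^sup>2 \<le> (norm ((p - x) + (w - p)))\<^sup>2" using R by (intro power_mono) auto
    moreover have "(norm (w - p))\<^sup>2 \<le> R\<^sup>2" using w(1) by (intro power_mono) auto
    \<comment> \<open>Equality in the triangle inequality through the midpoint, by the parallelogram law.\<close>
    ultimately have "(norm ((p - x) - (w - p)))\<^sup>2 \<le> 0"
      unfolding parallelogram px by (simp add: power2_eq_square)
    then have "(p - x) - (w - p) = 0"
      by (simp only: power2_less_eq_zero_iff norm_eq_zero)
    then have "w - p = y - p" by (simp only: half right_minus_eq)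
    then have "w = y" by simp
    with w show False by simp
  qed
  define r where "r = R / 2"
  have r: "r > 0" using R by (simp add: r_def)
  have "p \<notin> cball y r" using yp R by (simp add: r_def dist_norm)
  from exponential_barrier_constant[OF compact_cball this]
  obtain \<alpha> where \<alpha>: "\<alpha> > 0" "\<forall>x\<in>cball y r.
    2 * trace (matrix_inv (H x)) - real CARD('n) * (x \<bullet> (x - p))
      < 4 * \<alpha> * ((x - p) \<bullet> (matrix_inv (H x) *v (x - p)))" by blast
  define S where "S = sphere y r \<inter> cball p R"
  have "\<exists>\<epsilon>>0. \<forall>w\<in>S. m + \<epsilon> \<le> phase w"
  proof (cases "S = {}")
    case False
    have "compact S" unfolding S_def by (intro compact_Int_closed) auto
    then obtain w where w: "w \<in> S" "\<And>v. v \<in> S \<Longrightarrow> phase w \<le> phase v"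
      using continuous_attains_inf[OF _ False phase_continuous_on] by blast
    have "w \<noteq> y" "norm (w - p) \<le> R"
      using w(1) r by (auto simp: S_def dist_norm norm_minus_commute)
    then have "m < phase w" by (intro touch)
    then show ?thesis using w(2) by (intro exI[of _ "phase w - m"]) auto
  qed (auto intro: exI[of _ 1])
  then obtain \<epsilon> where \<epsilon>: "\<epsilon> > 0" "\<And>w. w \<in> S \<Longrightarrow> m + \<epsilon> \<le> phase w" by blast
  define f where "f w = phase w - \<epsilon> * exp (- \<alpha> * ((w - p) \<bullet> (w - p)))" for w
  have boundary: "f y < f w" if w: "w \<in> sphere y r" for w
  proof (cases "w \<in> S")
    case True
    have "f y < m" using y(1) \<epsilon>(1) by (simp add: f_def Z_def)
    also have "m \<le> phase w - \<epsilon>" using \<epsilon>(2)[OF True] by simp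
    also have "\<dots> \<le> f w" using \<epsilon>(1) \<alpha>(1) by (simp add: f_def)
    finally show ?thesis .
  next
    case False
    then have "R < norm (w - p)" using w by (simp add: S_def dist_norm norm_minus_commute)
    then have "(norm (y - p))\<^sup>2 < (norm (w - p))\<^sup>2"
      unfolding yp using R by (intro power_strict_mono) auto
    then have "exp (- \<alpha> * ((w - p) \<bullet> (w - p))) < exp (- \<alpha> * ((y - p) \<bullet> (y - p)))"
      using \<alpha>(1) by (simp add: power2_norm_eq_inner)
    then have "\<epsilon> * exp (- \<alpha> * ((w - p) \<bullet> (w - p))) < \<epsilon> * exp (- \<alpha> * ((y - p) \<bullet> (y - p)))"
      using \<epsilon>(1) by (rule mult_strict_left_mono)
    moreover have "phase y \<le> phase w" using y(1) min by (simp add: Z_def m_def)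
    ultimately show ?thesis by (simp add: f_def)
  qed
  have "\<exists>v\<in>cball y r. \<forall>w\<in>cball y r. f v \<le> f w"
  proof (rule continuous_attains_inf)
    show "continuous_on (cball y r) f"
      unfolding f_def by (intro continuous_intros phase_continuous_on)
  qed (use r in auto)
  then obtain v where v: "v \<in> cball y r" "\<And>w. w \<in> cball y r \<Longrightarrow> f v \<le> f w" by blast
  have "f v \<le> f y" using v(2) r by simp
  then have "v \<notin> sphere y r" using boundary[of v] by auto
  with v(1) have vr: "0 < r - dist y v" by (simp add: less_eq_real_def)
  show False
  proof (rule exponential_barrier_not_touching[OF \<alpha>(1) \<epsilon>(1) vr bspec[OF \<alpha>(2) v(1)]])
    fix w assume "w \<in> ball v (r - dist y v)"
    then have "w \<in> cball y r" using dist_triangle[of y w v] by simp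
    from v(2)[OF this]
    show "phase v - \<epsilon> * exp (- \<alpha> * ((v - p) \<bullet> (v - p))) \<le> phase w - \<epsilon> * exp (- \<alpha> * ((w - p) \<bullet> (w - p)))"
      by (simp add: f_def)
  qed
qed

section \<open>Constant phase and rigidity\<close>

text \<open>Vanishing of the gradient of the phase means \<open>H x x = g x\<close>. Hence \<open>g (s x) / s\<close> has zero
  derivative in \<open>s > 0\<close>, and its limit at \<open>0\<close> is \<open>H 0 x\<close>.\<close>

lemma gradient_linear_if_phase_constant:
  assumes const: "\<And>x. phase x = phase 0"
  shows "g x = H 0 *v x"
proof -
  have Hx: "H x *v x = g x" for x
  proof -
    have "phase = (\<lambda>_. phase 0)" using const by blast
    then have "(phase has_derivative (\<lambda>v. 0)) (at x)"
      using has_derivative_const[of "phase 0" "at x"] by simp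
    from has_derivative_unique[OF phase_has_derivative this]
    have "phase_grad x \<bullet> phase_grad x = 0" by meson
    then show ?thesis by (simp add: phase_grad_def)
  qed
  have g0: "g 0 = 0" using Hx[of 0] by simp
  have homog: "g (t *\<^sub>R x) = t *\<^sub>R g x" if t: "0 < t" for t
  proof -
    have "((\<lambda>s. (1 / s) *\<^sub>R g (s *\<^sub>R x)) has_derivative (\<lambda>h. 0)) (at s within {0<..})"
      if s: "s \<in> {0<..}" for s
    proof -
      have "((\<lambda>s. s *\<^sub>R x) has_derivative (\<lambda>h. h *\<^sub>R x)) (at s)"
        by (auto intro!: derivative_eq_intros)
      from has_derivative_compose[OF this grad_hess_hessian[OF C2]]
      have "((\<lambda>s. g (s *\<^sub>R x)) has_derivative (\<lambda>h. h *\<^sub>R (H (s *\<^sub>R x) *v x))) (at s)"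
        by (simp add: matrix_vector_mult_scaleR)
      moreover have "((\<lambda>s. 1 / s) has_derivative (\<lambda>h. - (h / s\<^sup>2))) (at s)"
        using s by (auto intro!: derivative_eq_intros simp: power2_eq_square field_simps)
      ultimately have "((\<lambda>s. (1 / s) *\<^sub>R g (s *\<^sub>R x)) has_derivative
          (\<lambda>h. (1 / s) *\<^sub>R (h *\<^sub>R (H (s *\<^sub>R x) *v x)) + (- (h / s\<^sup>2)) *\<^sub>R g (s *\<^sub>R x))) (at s)"
        by (intro has_derivative_scaleR)
      moreover have "g (s *\<^sub>R x) = s *\<^sub>R (H (s *\<^sub>R x) *v x)"
        using Hx[of "s *\<^sub>R x"] by (simp add: matrix_vector_mult_scaleR)
      ultimately have "((\<lambda>s. (1 / s) *\<^sub>R g (s *\<^sub>R x)) has_derivative (\<lambda>h. 0)) (at s)"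
        using s by (simp add: power2_eq_square)
      then show ?thesis by (rule has_derivative_at_withinI)
    qed
    from has_derivative_zero_constant[OF _ this]
    obtain c where c: "\<And>s. s \<in> {0<..} \<Longrightarrow> (1 / s) *\<^sub>R g (s *\<^sub>R x) = c" by auto
    have "(1 / t) *\<^sub>R g (t *\<^sub>R x) = g x" using c[of t] c[of 1] t by simp
    then have "t *\<^sub>R ((1 / t) *\<^sub>R g (t *\<^sub>R x)) = t *\<^sub>R g x" by simp
    then show ?thesis using t by simp
  qed
  have nx: "norm x + 1 > 0" "norm x + 1 \<noteq> 0" using norm_ge_zero[of x] by linarith+
  have "norm (g x - H 0 *v x) \<le> 0 + e" if e: "e > 0" for e
  proof -
    define \<eta> where "\<eta> = e / (norm x + 1)"
    have \<eta>: "\<eta> > 0" using e nx by (simp add: \<eta>_def)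
    obtain d where d: "d > 0"
      "\<And>y. norm (y - 0) < d \<Longrightarrow> norm (g y - g 0 - H 0 *v (y - 0)) \<le> \<eta> * norm (y - 0)"
      using grad_hess_hessian[OF C2, of 0] \<eta> unfolding has_derivative_at_alt by blast
    define t where "t = d / (norm x + 1)"
    have t: "t > 0" using d nx by (simp add: t_def)
    have "t * norm x < t * (norm x + 1)" using t by simp
    also have "\<dots> = d" using nx by (simp add: t_def)
    finally have "norm (t *\<^sub>R x - 0) < d" using t by simp
    from d(2)[OF this] have "norm (t *\<^sub>R (g x - H 0 *v x)) \<le> \<eta> * (t * norm x)"
      using t by (simp add: g0 homog matrix_vector_mult_scaleR scaleR_diff_right)
    then have "t * norm (g x - H 0 *v x) \<le> t * (\<eta> * norm x)" using t by (simp add: mult_ac)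
    then have "norm (g x - H 0 *v x) \<le> \<eta> * norm x" using t by simp
    also have "\<dots> \<le> \<eta> * (norm x + 1)" using \<eta> by simp
    also have "\<dots> = e" using nx by (simp add: \<eta>_def)
    finally show ?thesis by simp
  qed
  then have "norm (g x - H 0 *v x) \<le> 0" by (rule field_le_epsilon)
  then show ?thesis by simp
qed

lemma quadratic_if_hessian_decays_slowly:
  assumes c: "c > 2 * (real CARD('n) - 1) / real CARD('n)"
    and low: "\<And>x w. R0 \<le> norm x \<Longrightarrow> c * (w \<bullet> w) \<le> (norm x)\<^sup>2 * (w \<bullet> (H x *v w))"
  shows "u x = u 0 + 1 / 2 * (x \<bullet> (H 0 *v x))"
proof -
  obtain z where "\<And>x. phase z \<le> phase x" using phase_attains_min[OF c low] by blast
  then have "phase x = phase z" for x by (rule strong_minimum_principle)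
  then have const: "phase x = phase 0" for x by metis
  have "real CARD('n) * (- u x + 1 / 2 * (x \<bullet> g x)) = real CARD('n) * (- u 0 + 1 / 2 * (0 \<bullet> g 0))"
    using const[of x] by (simp only: phase_def)
  then have "- u x + 1 / 2 * (x \<bullet> g x) = - u 0 + 1 / 2 * (0 \<bullet> g 0)"
    unfolding mult_cancel_left by simp
  then show ?thesis
    using gradient_linear_if_phase_constant[OF const, of x] by simp
qed

end

text \<open>The Hessian of a convex function is positive semidefinite; a null vector of the form would lie in its
  kernel, contradicting the nonzero determinant.\<close>

lemma convex_solution_hessian_pos_def:
  assumes C2: "grad_hess u g H" and conv: "strictly_convex u" and d: "det (H x) > 0"
  shows "pos_def (H x)"
  unfolding pos_def_def
proof (intro conjI allI impI)
  show sym: "transpose (H x) = H x" by (rule grad_hess_symmetric[OF C2])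
  fix v :: "real ^ 'a" assume v: "v \<noteq> 0"
  show "0 < v \<bullet> (H x *v v)"
  proof (rule ccontr)
    assume "\<not> 0 < v \<bullet> (H x *v v)"
    then have vHv: "v \<bullet> (H x *v v) = 0" using convex_hessian_psd[OF C2 conv, of v x] by simp
    have "(H x *v v) \<bullet> (H x *v v) = 0"
      by (rule psd_kernel[OF sym subspace_UNIV]) (simp_all add: vHv convex_hessian_psd[OF C2 conv])
    then have "H x *v v = 0" by simp
    moreover have "matrix_inv (H x) *v (H x *v v) = v"
      using d by (simp add: matrix_vector_mul_assoc matrix_inv_inverse)
    ultimately show False using v by simp
  qed
qed

theorem theorem1p5:
  fixes u :: "real ^ 'n \<Rightarrow> real"
  assumes C2: "C2_on_space u"
    and convex: "strictly_convex u"
    and equation: "\<And>x. det (hessian u x) =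
          exp (real CARD('n) * (- u x + 1 / 2 * (\<Sum>i\<in>UNIV. x $ i * partial_deriv i u x)))"
    and growth: "Liminf at_infinity
          (\<lambda>x. ereal ((norm x)\<^sup>2 * smallest_eigenvalue (hessian u x)))
        > ereal (2 * (real CARD('n) - 1) / real CARD('n))"
  shows "quadratic_polynomial u \<and>
    (\<exists>A :: real ^ 'n ^ 'n. transpose A = A \<and>
      (\<forall>x. u x = u 0 + 1 / 2 * (x \<bullet> (A *v x))) \<and>
      det A = exp (- real CARD('n) * u 0))"
proof -
  define g where "g = (\<lambda>x. \<chi> i. partial_deriv i u x)"
  have gh: "grad_hess u g (hessian u)"
    unfolding g_def by (rule C2_on_space_grad_hess[OF C2])
  have eq: "det (hessian u x) = exp (real CARD('n) * (- u x + 1 / 2 * (x \<bullet> g x)))" for x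
    using equation[of x] by (simp add: g_def inner_vec_def)
  interpret self_shrinking_potential u g "hessian u"
  proof
    show "pos_def (hessian u x)" for x
      by (rule convex_solution_hessian_pos_def[OF gh convex]) (simp add: eq)
  qed (rule gh eq)+
  have sym: "transpose (hessian u x) = hessian u x" for x
    by (rule grad_hess_symmetric[OF gh])
  obtain b where b: "ereal (2 * (real CARD('n) - 1) / real CARD('n)) < ereal b"
    "ereal b < Liminf at_infinity (\<lambda>x. ereal ((norm x)\<^sup>2 * smallest_eigenvalue (hessian u x)))"
    using ereal_dense2[OF growth] by blast
  from less_LiminfD[OF b(2)] obtain R0 where
    R0: "\<And>x. R0 \<le> norm x \<Longrightarrow> b < (norm x)\<^sup>2 * smallest_eigenvalue (hessian u x)"
    unfolding eventually_at_infinity by auto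
  have low: "b * (w \<bullet> w) \<le> (norm x)\<^sup>2 * (w \<bullet> (hessian u x *v w))" if "R0 \<le> norm x" for x w
  proof -
    have "b * (w \<bullet> w) \<le> ((norm x)\<^sup>2 * smallest_eigenvalue (hessian u x)) * (w \<bullet> w)"
      using R0[OF that] by (intro mult_right_mono) auto
    also have "\<dots> = (norm x)\<^sup>2 * (smallest_eigenvalue (hessian u x) * (w \<bullet> w))" by simp
    also have "\<dots> \<le> (norm x)\<^sup>2 * (w \<bullet> (hessian u x *v w))"
      by (intro mult_left_mono smallest_eigenvalue_le_form sym) simp
    finally show ?thesis .
  qed
  define A where "A = hessian u 0"
  have quad: "u x = u 0 + 1 / 2 * (x \<bullet> (A *v x))" for x
    unfolding A_def using b(1) low by (intro quadratic_if_hessian_decays_slowly) auto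
  have detA: "det A = exp (- real CARD('n) * u 0)"
    using eq[of 0] by (simp add: A_def)
  have "A \<noteq> 0"
  proof
    assume "A = 0"
    then have "det A = 0" using det_0[where 'n = 'n and 'a = real] by simp
    with detA show False by simp
  qed
  have "quadratic_polynomial u"
    unfolding quadratic_polynomial_def
  proof (intro exI conjI allI)
    show "transpose ((1 / 2) *\<^sub>R A) = (1 / 2) *\<^sub>R A" by (simp add: transpose_scalar A_def sym)
    show "(1 / 2) *\<^sub>R A \<noteq> 0" using \<open>A \<noteq> 0\<close> by simp
    show "u x = x \<bullet> ((1 / 2) *\<^sub>R A *v x) + 0 \<bullet> x + u 0" for x
      using quad[of x] by (simp flip: scaleR_matrix_vector_assoc)
  qed
  moreover have "transpose A = A" by (simp add: A_def sym)
  ultimately show ?thesis using quad detA by blast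
qed

end
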